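(* Let $\mathcal{H}$ be a complex Hilbert space and let $T$ be a bounded linear operator on $\mathcal{H}$ that is absolute-$(p,r)$-paranormal for some real numbers $p,r>0$. If $T^2$ is compact, then $T$ is normal.
   Context: For a bounded linear operator $T$ on a complex Hilbert space $\mathcal{H}$, $|T|=(T^*T)^{1/2}$ and $|T^*|=(TT^* )^{1/2}$; real positive powers of positive operators are defined by functional calculus. For $p,r>0$, $T$ is called absolute-$(p,r)$-paranormal if $\| |T|^p |T^*|^r x \|^r \geq \| |T^*|^r x \|^{p+r}$ for every unit vector $x\in\mathcal{H}$ (equivalently, $\| |T|^p |T^*|^r x \|^r\|x\|^p \geq \| |T^*|^r x \|^{p+r}$ for all $x\in\mathcal{H}$). An operator $A$ is normal if $A^*A=AA^*$. *)

theory Defs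
  imports "HOL-Analysis.Analysis" "HOL-Computational_Algebra.Polynomial"
begin

section \<open>Complex Hilbert spaces\<close>

text \<open>
  A complex inner product space, over the library's real one: the real inner product is the
  real part of the complex inner product, so that positive definiteness and
  \<open>norm x = sqrt (Re (cinner x x))\<close> come from class \<^class>\<open>real_inner\<close> (see the lemma
  \<open>cinner_self\<close> below). The inner product is linear in its first argument.
\<close>

class complex_inner = real_inner +
  fixes scaleC :: "complex \<Rightarrow> 'a \<Rightarrow> 'a"  (infixr \<open>*\<^sub>C\<close> 75)
    and cinner :: "'a \<Rightarrow> 'a \<Rightarrow> complex"
  assumes scaleC_add_right: "c *\<^sub>C (x + y) = c *\<^sub>C x + c *\<^sub>C y"
    and scaleC_add_left: "(c + d) *\<^sub>C x = c *\<^sub>C x + d *\<^sub>C x"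
    and scaleC_scaleC: "c *\<^sub>C (d *\<^sub>C x) = (c * d) *\<^sub>C x"
    and scaleC_one: "1 *\<^sub>C x = x"
    and scaleR_scaleC: "a *\<^sub>R x = complex_of_real a *\<^sub>C x"
    and cinner_commute: "cinner x y = cnj (cinner y x)"
    and cinner_add_left: "cinner (x + y) z = cinner x z + cinner y z"
    and cinner_scaleC_left: "cinner (c *\<^sub>C x) y = c * cinner x y"
    and inner_Re_cinner: "inner x y = Re (cinner x y)"

class complex_hilbert = complex_inner + complete_space

lemma cinner_self:
  fixes x :: "'a :: complex_inner"
  shows "cinner x x = complex_of_real ((norm x)\<^sup>2)"
proof -
  have "Im (cinner x x) = 0"
    using cinner_commute[of x x] by (metis cnj.simps(2) equal_neg_zero)
  moreover have "Re (cinner x x) = (norm x)\<^sup>2"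
    by (simp add: power2_norm_eq_inner inner_Re_cinner)
  ultimately show ?thesis by (simp add: complex_eq_iff)
qed

instantiation complex :: complex_hilbert
begin

definition scaleC_complex :: "complex \<Rightarrow> complex \<Rightarrow> complex" where
  "scaleC_complex c x = c * x"

definition cinner_complex :: "complex \<Rightarrow> complex \<Rightarrow> complex" where
  "cinner_complex x y = x * cnj y"

instance
  by standard
    (auto simp: scaleC_complex_def cinner_complex_def inner_complex_def algebra_simps
      scaleR_conv_of_real)

end

section \<open>Bounded operators\<close>

definition bounded_clinear :: "('a::complex_inner \<Rightarrow> 'a) \<Rightarrow> bool" where
  "bounded_clinear T \<longleftrightarrow> bounded_linear T \<and> (\<forall>c x. T (c *\<^sub>C x) = c *\<^sub>C T x)"

text \<open>For a bounded operator on a Hilbert space, existence is the Riesz representation theorem.\<close>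

definition cadjoint :: "('a::complex_inner \<Rightarrow> 'a) \<Rightarrow> 'a \<Rightarrow> 'a" where
  "cadjoint T = (THE S. \<forall>x y. cinner (T x) y = cinner x (S y))"

definition normal_op :: "('a::complex_inner \<Rightarrow> 'a) \<Rightarrow> bool" where
  "normal_op A \<longleftrightarrow> cadjoint A \<circ> A = A \<circ> cadjoint A"

definition compact_op :: "('a::complex_inner \<Rightarrow> 'a) \<Rightarrow> bool" where
  "compact_op A \<longleftrightarrow> (\<forall>B. bounded B \<longrightarrow> compact (closure (A ` B)))"

section \<open>Functional calculus and absolute-(p,r)-paranormal operators\<close>

definition spectrum_op :: "('a::complex_inner \<Rightarrow> 'a) \<Rightarrow> complex set" where
  "spectrum_op A = {z. \<not> (\<exists>S. bounded_clinear S \<and>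
      (\<forall>x. S (A x - z *\<^sub>C x) = x) \<and> (\<forall>x. A (S x) - z *\<^sub>C S x = x))}"

definition poly_op :: "complex poly \<Rightarrow> ('a::complex_inner \<Rightarrow> 'a) \<Rightarrow> 'a \<Rightarrow> 'a" where
  "poly_op q A x = (\<Sum>i\<le>degree q. coeff q i *\<^sub>C (A ^^ i) x)"

text \<open>
  Continuous functional calculus: \<open>f(A)\<close> is the operator-norm limit of \<open>q\<^sub>n(A)\<close> for
  polynomials \<open>q\<^sub>n\<close> converging to \<open>f\<close> uniformly on the spectrum of \<open>A\<close>. For bounded self-adjoint
  \<open>A\<close> and \<open>f\<close> continuous on the spectrum, the limit exists and does not depend on the sequence.
  The spectrum of such an \<open>A\<close> is a compact set of reals, so the Weierstrass theorem supplies a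
  sequence and the limit is unique. The definition is meaningful for these \<open>A\<close> and \<open>f\<close> only.
\<close>

definition fun_calc :: "(complex \<Rightarrow> complex) \<Rightarrow> ('a::complex_inner \<Rightarrow> 'a) \<Rightarrow> 'a \<Rightarrow> 'a" where
  "fun_calc f A = (THE S. bounded_clinear S \<and>
     (\<forall>q :: nat \<Rightarrow> complex poly.
        uniform_limit (spectrum_op A) (\<lambda>n. poly (q n)) f sequentially \<longrightarrow>
        (\<lambda>n. onorm (\<lambda>x. poly_op (q n) A x - S x)) \<longlonglongrightarrow> 0))"

text \<open>
  \<open>A\<^sup>s\<close> for positive \<open>A\<close> and real \<open>s > 0\<close>. The spectrum lies in the nonnegative reals, where
  \<open>\<lambda>z. Re z powr s\<close> is \<open>t \<mapsto> t\<^sup>s\<close>, with value \<open>0\<close> at \<open>0\<close>.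
\<close>

definition op_powr :: "('a::complex_inner \<Rightarrow> 'a) \<Rightarrow> real \<Rightarrow> 'a \<Rightarrow> 'a" where
  "op_powr A s = fun_calc (\<lambda>z. complex_of_real (Re z powr s)) A"

definition abs_op :: "('a::complex_inner \<Rightarrow> 'a) \<Rightarrow> 'a \<Rightarrow> 'a" where
  "abs_op T = op_powr (cadjoint T \<circ> T) (1/2)"

definition abs_star_op :: "('a::complex_inner \<Rightarrow> 'a) \<Rightarrow> 'a \<Rightarrow> 'a" where
  "abs_star_op T = op_powr (T \<circ> cadjoint T) (1/2)"

definition absolute_paranormal :: "real \<Rightarrow> real \<Rightarrow> ('a::complex_inner \<Rightarrow> 'a) \<Rightarrow> bool" where
  "absolute_paranormal p r T \<longleftrightarrow>
     (\<forall>x. norm x = 1 \<longrightarrow>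
        norm (op_powr (abs_op T) p (op_powr (abs_star_op T) r x)) powr r
          \<ge> norm (op_powr (abs_star_op T) r x) powr (p + r))"

end

theory Submission
  imports Defs "HOL-Computational_Algebra.Fundamental_Theorem_Algebra" "HOL-Library.Diagonal_Subsequence"
begin

text \<open>
  Write \<open>A = T\<^sup>* T\<close> and \<open>B = T T\<^sup>*\<close>, so that \<open>|T|\<close> and \<open>|T\<^sup>*|\<close> are the positive square roots of \<open>A\<close> and
  \<open>B\<close>; normality means \<open>A = B\<close>.

  Compactness of \<open>T\<^sup>2\<close> first spreads to \<open>T\<close>. The operator \<open>A B = T\<^sup>* T\<^sup>2 T\<^sup>*\<close> is compact. A power \<open>C\<^sup>s\<close> of a positive
  operator is a norm limit of polynomials in \<open>C\<close> without constant term, so compactness passes from \<open>C X\<close> to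
  \<open>C\<^sup>s X\<close> and from \<open>X C\<close> to \<open>X C\<^sup>s\<close>; hence \<open>K = |T|\<^sup>p |T\<^sup>*|\<^sup>r\<close> is compact. Paranormality bounds \<open>|T\<^sup>*|\<^sup>r x\<close> by \<open>K x\<close>,
  which makes \<open>|T\<^sup>*|\<^sup>r\<close> compact, then \<open>|T\<^sup>*|\<close>, then \<open>T\<^sup>*\<close> and \<open>A\<close> (\<open>compact_square_imp_compact\<close>).

  The second half compares top eigenspaces. Let \<open>W\<close> be a closed subspace invariant under \<open>T\<close> and \<open>T\<^sup>*\<close> on which
  \<open>T\<close> has norm \<open>m > 0\<close>. If \<open>y \<in> W\<close> and \<open>B y = m\<^sup>2 y\<close>, then \<open>|T\<^sup>*|\<^sup>r y = m\<^sup>r y\<close> and paranormality gives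
  \<open>\<parallel>|T|\<^sup>p y\<parallel> \<ge> m\<^sup>p \<parallel>y\<parallel>\<close>. Since \<open>|T|\<close> has norm at most \<open>m\<close> on \<open>W\<close>, this forces \<open>A y = m\<^sup>2 y\<close>
  (\<open>eigenvector_transfer\<close>). Thus \<open>T\<close> maps the eigenspace \<open>M\<close> of \<open>A\<close> for \<open>m\<^sup>2\<close> in \<open>W\<close> into that of \<open>B\<close>, which lies in
  \<open>M\<close>, and \<open>T / m\<close> is an isometry of \<open>M\<close> into itself. By compactness the orbits of this isometry return
  arbitrarily close to their starting points, so every vector of \<open>M\<close> is a limit of eigenvectors of \<open>B\<close>
  and \<open>M\<close> is an eigenspace of \<open>B\<close> as well (\<open>eigenvector_recurrence\<close>). Hence \<open>M\<close> is invariant under \<open>T\<close> and \<open>T\<^sup>*\<close>, and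
  \<open>A = B\<close> on it.

  Let \<open>N\<close> be the largest set that is invariant under \<open>T\<close> and \<open>T\<^sup>*\<close> and on which \<open>A = B\<close>, and let \<open>W\<close> be its
  orthogonal complement. If \<open>T\<close> did not vanish on \<open>W\<close>, compactness would supply a nonzero top
  eigenvector in \<open>W\<close>, which would belong to \<open>N\<close> by the preceding paragraph. So \<open>T\<close> and \<open>T\<^sup>*\<close> vanish on \<open>W\<close>, therefore
  \<open>W \<subseteq> N\<close> and \<open>W = 0\<close>. The range of \<open>A - B\<close> is orthogonal to \<open>N\<close>, so it is \<open>0\<close>.

  The powers come from the continuous functional calculus. It rests on the estimate that
  \<open>\<parallel>q(A) y\<parallel> \<le> c \<parallel>y\<parallel>\<close> on an invariant subspace \<open>W\<close> whenever \<open>|q| \<le> c\<close> on the approximate point spectrum of \<open>A\<close>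
  on \<open>W\<close> (\<open>norm_poly_op_le\<close>). Taking \<open>W\<close> to be the whole space yields the calculus itself, and smaller
  \<open>W\<close> yield the bounds on \<open>|T|\<^sup>p\<close> used above.
\<close>

section \<open>Complex inner product spaces\<close>

lemma scaleC_zero_right [simp]: "c *\<^sub>C (0::'a::complex_inner) = 0"
  using scaleC_add_right[of c "0::'a" 0] by simp

lemma scaleC_zero_left [simp]: "0 *\<^sub>C (x::'a::complex_inner) = 0"
  using scaleC_add_left[of 0 0 x] by simp

lemma scaleC_minus_right [simp]: "c *\<^sub>C (- x::'a::complex_inner) = - (c *\<^sub>C x)"
  using scaleC_add_right[of c x "- x"] by (simp add: minus_equation_iff add_eq_0_iff)

lemma scaleC_minus_left [simp]: "(- c) *\<^sub>C (x::'a::complex_inner) = - (c *\<^sub>C x)"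
  using scaleC_add_left[of c "- c" x] by (simp add: add_eq_0_iff)

lemma scaleC_diff_right: "c *\<^sub>C (x - y::'a::complex_inner) = c *\<^sub>C x - c *\<^sub>C y"
  using scaleC_add_right[of c x "- y"] by simp

lemma scaleC_diff_left: "(c - d) *\<^sub>C (x::'a::complex_inner) = c *\<^sub>C x - d *\<^sub>C x"
  using scaleC_add_left[of c "- d" x] by simp

lemma inner_scaleC_left:
  fixes x y :: "'a::complex_inner"
  shows "inner (c *\<^sub>C x) y = inner x (cnj c *\<^sub>C y)"
proof -
  have "cinner x (cnj c *\<^sub>C y) = cnj (cnj c * cinner y x)"
    by (subst cinner_commute) (simp add: cinner_scaleC_left)
  also have "\<dots> = cinner (c *\<^sub>C x) y"
    using cinner_commute[of x y] by (simp add: cinner_scaleC_left)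
  finally show ?thesis by (simp add: inner_Re_cinner)
qed

lemma norm_scaleC [simp]: "norm (c *\<^sub>C (x::'a::complex_inner)) = cmod c * norm x"
proof -
  have "(norm (c *\<^sub>C x))\<^sup>2 = inner x ((cnj c * c) *\<^sub>C x)"
    by (simp add: power2_norm_eq_inner inner_scaleC_left scaleC_scaleC)
  also have "cnj c * c = complex_of_real ((cmod c)\<^sup>2)"
    using complex_norm_square[of c] by (simp add: mult.commute)
  also have "inner x (complex_of_real ((cmod c)\<^sup>2) *\<^sub>C x) = (cmod c * norm x)\<^sup>2"
    by (simp add: scaleR_scaleC[symmetric] power_mult_distrib power2_norm_eq_inner del: of_real_power)
  finally show ?thesis by (simp add: power2_eq_iff_nonneg)
qed

lemma bounded_linear_scaleC: "bounded_linear (\<lambda>x::'a::complex_inner. c *\<^sub>C x)"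
  by (rule bounded_linear_intro[where K = "cmod c"])
     (auto simp: scaleC_add_right scaleR_scaleC scaleC_scaleC mult.commute)

text \<open>
  The complex inner product is determined by its real part, so adjoints, orthogonality and norms can all
  be handled with the real inner product.
\<close>

lemma cinner_eq_inner:
  fixes x y :: "'a::complex_inner"
  shows "cinner x y = Complex (inner x y) (- inner (\<i> *\<^sub>C x) y)"
  by (simp add: complex_eq_iff inner_Re_cinner cinner_scaleC_left)

lemma norm_diff_scaleR_power2:
  fixes x y :: "'a::real_inner"
  shows "(norm (x - a *\<^sub>R y))\<^sup>2 = (norm x)\<^sup>2 - 2 * a * inner x y + a\<^sup>2 * (norm y)\<^sup>2"
  unfolding power2_norm_eq_inner
  by (simp add: algebra_simps inner_commute power2_eq_square)

subsection \<open>Bounded complex linear operators\<close>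

lemma bounded_clinearD:
  assumes "bounded_clinear A"
  shows "A (x + y) = A x + A y" "A (x - y) = A x - A y" "A 0 = 0" "A (- x) = - A x"
    "A (c *\<^sub>C x) = c *\<^sub>C A x" "A (a *\<^sub>R x) = a *\<^sub>R A x" "bounded_linear A"
  using assms unfolding bounded_clinear_def
  by (auto simp: linear_simps)

lemma bounded_clinear_scaleC_comp:
  assumes "bounded_clinear A"
  shows "bounded_clinear (\<lambda>x. c *\<^sub>C A x)"
  using assms bounded_linear_compose[OF bounded_linear_scaleC, of A c]
  unfolding bounded_clinear_def by (auto simp: scaleC_scaleC mult.commute)

lemma bounded_clinear_add:
  assumes "bounded_clinear A" "bounded_clinear B"
  shows "bounded_clinear (\<lambda>x. A x + B x)"
  using assms unfolding bounded_clinear_def by (auto simp: scaleC_add_right intro: bounded_linear_add)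

lemma bounded_clinear_diff:
  assumes "bounded_clinear A" "bounded_clinear B"
  shows "bounded_clinear (\<lambda>x. A x - B x)"
  using assms unfolding bounded_clinear_def by (auto simp: scaleC_diff_right intro: bounded_linear_sub)

lemma bounded_clinear_comp:
  assumes "bounded_clinear A" "bounded_clinear B"
  shows "bounded_clinear (\<lambda>x. A (B x))"
  using assms unfolding bounded_clinear_def by (auto intro: bounded_linear_compose)

lemma bounded_clinear_ident: "bounded_clinear (\<lambda>x. x)"
  unfolding bounded_clinear_def by (auto intro: bounded_linear_ident)

lemma bounded_clinear_scaleC: "bounded_clinear (\<lambda>x. c *\<^sub>C x)"
  by (rule bounded_clinear_scaleC_comp[OF bounded_clinear_ident])

lemma bounded_clinear_zero: "bounded_clinear (\<lambda>x. 0)"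
  unfolding bounded_clinear_def by (auto intro: bounded_linear_zero)

lemma bounded_clinear_bound:
  assumes "bounded_clinear A"
  obtains K where "K > 0" "\<And>x. norm (A x) \<le> K * norm x"
  using bounded_linear.pos_bounded[of A] assms unfolding bounded_clinear_def
  by (metis mult.commute)

lemma bounded_clinearI:
  assumes "\<And>x y. A (x + y) = A x + A y" "\<And>c x. A (c *\<^sub>C x) = c *\<^sub>C A x"
    and "\<And>x. norm (A x) \<le> K * norm x"
  shows "bounded_clinear A"
  unfolding bounded_clinear_def
  using assms by (auto intro!: bounded_linear_intro[where K = K] simp: scaleR_scaleC mult.commute)

section \<open>Projections, the Riesz representation and adjoints\<close>

text \<open>
  A minimizing sequence for the distance from \<open>x\<close> to \<open>V\<close> is Cauchy by the parallelogram law; at the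
  minimizer the derivative of the squared distance vanishes in every direction of \<open>V\<close>.
\<close>

lemma exists_orthogonal_to_closed_subspace:
  fixes V :: "'a::{real_inner,complete_space} set"
  assumes V: "subspace V" "closed V" and x: "x \<notin> V"
  obtains w where "w \<noteq> 0" "\<And>u. u \<in> V \<Longrightarrow> inner w u = 0"
proof -
  define d where "d = infdist x V"
  have ne: "V \<noteq> {}" using V subspace_0 by auto
  have d0: "d \<ge> 0" by (simp add: d_def infdist_nonneg)
  have dle: "d \<le> norm (x - v)" if "v \<in> V" for v
    using infdist_le[OF that, of x] by (simp add: d_def dist_norm)
  have "\<exists>v\<in>V. norm (x - v) < d + 1 / real (Suc n)" for n
  proof -
    have "infdist x V < d + 1 / real (Suc n)" by (simp add: d_def)
    then have "(INF v\<in>V. dist x v) < d + 1 / real (Suc n)" using ne by (simp add: infdist_def)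
    then show ?thesis
      by (subst (asm) cINF_less_iff) (auto simp: ne dist_norm intro!: bdd_belowI2[of _ 0])
  qed
  then obtain v where v: "\<And>n. v n \<in> V" "\<And>n. norm (x - v n) < d + 1 / real (Suc n)" by metis
  have lim: "(\<lambda>n. norm (x - v n)) \<longlonglongrightarrow> d"
  proof (rule tendsto_sandwich[OF _ _ tendsto_const])
    show "(\<lambda>n. d + 1 / real (Suc n)) \<longlonglongrightarrow> d"
      using tendsto_add[OF tendsto_const[of d] LIMSEQ_inverse_real_of_nat] by (simp add: divide_inverse)
    show "\<forall>\<^sub>F n in sequentially. d \<le> norm (x - v n)" using dle v by simp
    show "\<forall>\<^sub>F n in sequentially. norm (x - v n) \<le> d + 1 / real (Suc n)"
      using v(2) by (simp add: less_imp_le)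
  qed
  have para: "(norm (v m - v n))\<^sup>2 \<le> 2 * ((norm (x - v m))\<^sup>2 - d\<^sup>2) + 2 * ((norm (x - v n))\<^sup>2 - d\<^sup>2)" for m n
  proof -
    have "(1/2) *\<^sub>R (v m + v n) \<in> V" using V v by (simp add: subspace_add subspace_scale)
    then have "d\<^sup>2 \<le> (norm (x - (1/2) *\<^sub>R (v m + v n)))\<^sup>2" using dle d0 by (simp add: power_mono)
    moreover have "(norm (v m - v n))\<^sup>2 + 4 * (norm (x - (1/2) *\<^sub>R (v m + v n)))\<^sup>2
        = 2 * (norm (x - v m))\<^sup>2 + 2 * (norm (x - v n))\<^sup>2"
      unfolding power2_norm_eq_inner
      by (simp add: algebra_simps inner_commute)
    ultimately show ?thesis by simp
  qed
  have "Cauchy v"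
  proof (rule metric_CauchyI)
    fix e :: real assume e: "e > 0"
    have "(\<lambda>n. 4 * ((norm (x - v n))\<^sup>2 - d\<^sup>2)) \<longlonglongrightarrow> 4 * (d\<^sup>2 - d\<^sup>2)"
      by (intro tendsto_intros lim)
    then have "\<forall>\<^sub>F n in sequentially. 4 * ((norm (x - v n))\<^sup>2 - d\<^sup>2) < e\<^sup>2"
      by (rule order_tendstoD) (use e in simp)
    then obtain N where N: "\<And>n. n \<ge> N \<Longrightarrow> 4 * ((norm (x - v n))\<^sup>2 - d\<^sup>2) < e\<^sup>2"
      by (auto simp: eventually_sequentially)
    have "dist (v m) (v n) < e" if "m \<ge> N" "n \<ge> N" for m n
    proof -
      have "(norm (v m - v n))\<^sup>2 < e\<^sup>2" using para[of m n] N[OF that(1)] N[OF that(2)] by linarith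
      then show ?thesis using e by (simp add: dist_norm power2_less_imp_less)
    qed
    then show "\<exists>N. \<forall>m\<ge>N. \<forall>n\<ge>N. dist (v m) (v n) < e" by blast
  qed
  then obtain l where l: "v \<longlonglongrightarrow> l" using Cauchy_convergent convergent_def by blast
  have lV: "l \<in> V" using closed_sequentially[OF V(2) _ l] v by simp
  have "(\<lambda>n. norm (x - v n)) \<longlonglongrightarrow> norm (x - l)" by (intro tendsto_intros l)
  then have nl: "norm (x - l) = d" using lim LIMSEQ_unique by blast
  show ?thesis
  proof
    show "x - l \<noteq> 0" using lV x by auto
  next
    fix u assume u: "u \<in> V"
    show "inner (x - l) u = 0"
    proof (cases "u = 0")
      case False
      \<comment> \<open>The step length that minimizes the distance along \<open>u\<close>.\<close>
      define a where "a = inner (x - l) u / (norm u)\<^sup>2"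
      have "l + a *\<^sub>R u \<in> V" using V lV u by (simp add: subspace_add subspace_scale)
      then have "d \<le> norm ((x - l) - a *\<^sub>R u)" using dle by (simp add: algebra_simps)
      then have "d\<^sup>2 \<le> (norm ((x - l) - a *\<^sub>R u))\<^sup>2" using d0 by (simp add: power_mono)
      also have "\<dots> = d\<^sup>2 - 2 * a * inner (x - l) u + a\<^sup>2 * (norm u)\<^sup>2"
        by (simp only: norm_diff_scaleR_power2 nl)
      also have "\<dots> = d\<^sup>2 - a\<^sup>2 * (norm u)\<^sup>2"
        using False by (simp add: a_def power2_eq_square field_simps)
      finally have "a\<^sup>2 * (norm u)\<^sup>2 \<le> 0" by simp
      then have "a = 0" using False by (simp add: mult_le_0_iff)
      then show ?thesis using False by (simp add: a_def)
    qed simp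
  qed
qed

text \<open>
  The kernel of a nonzero functional has a nonzero normal vector \<open>w\<close>, and \<open>f x w - f w x\<close> always lies in
  the kernel.
\<close>

lemma riesz_representation_real:
  fixes f :: "'a::{real_inner,complete_space} \<Rightarrow> real"
  assumes f: "bounded_linear f"
  obtains s where "\<And>x. f x = inner x s"
proof (cases "\<forall>x. f x = 0")
  case True
  then show ?thesis using that[of 0] by simp
next
  case False
  interpret f: bounded_linear f by fact
  let ?V = "{x. f x = 0}"
  have "subspace ?V" by (auto simp: subspace_def f.add f.scaleR f.zero)
  moreover have "closed ?V"
    by (intro closed_Collect_eq continuous_on_const linear_continuous_on f)
  moreover obtain x where "x \<notin> ?V" using False by auto
  ultimately obtain w where w: "w \<noteq> 0" "\<And>u. u \<in> ?V \<Longrightarrow> inner w u = 0"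
    using exists_orthogonal_to_closed_subspace by metis
  show ?thesis
  proof
    fix x
    have "f x *\<^sub>R w - f w *\<^sub>R x \<in> ?V" by (simp add: f.diff f.scaleR)
    then have "inner w (f x *\<^sub>R w - f w *\<^sub>R x) = 0" by (rule w)
    then have "f x * inner w w = f w * inner w x" by (simp add: inner_diff_right)
    then show "f x = inner x ((f w / inner w w) *\<^sub>R w)"
      using w(1) by (simp add: field_simps inner_commute)
  qed
qed

text \<open>
  Only the real parts are compared; for complex linear operators this is the usual adjoint relation.
\<close>

definition is_adjoint :: "('a::complex_inner \<Rightarrow> 'a) \<Rightarrow> ('a \<Rightarrow> 'a) \<Rightarrow> bool" where
  "is_adjoint A B \<longleftrightarrow> (\<forall>x y. inner (A x) y = inner x (B y))"

lemma is_adjoint_sym: "is_adjoint A B \<Longrightarrow> is_adjoint B A"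
  unfolding is_adjoint_def by (metis inner_commute)

lemma is_adjoint_bounded_clinear:
  assumes A: "bounded_clinear A" and B: "is_adjoint A B"
  shows "bounded_clinear B"
proof -
  note AB = B[unfolded is_adjoint_def, rule_format, symmetric]
  obtain K where K: "K > 0" "\<And>x. norm (A x) \<le> K * norm x" using bounded_clinear_bound[OF A] by blast
  have eqI: "u = v" if "\<And>x. inner x u = inner x v" for u v :: 'a
    by (rule vector_eq_ldot[THEN iffD1]) (use that in blast)
  show ?thesis
  proof (rule bounded_clinearI)
    fix x y
    show "B (x + y) = B x + B y" by (rule eqI) (simp add: AB inner_add_right)
  next
    fix c x
    have "inner z (B (c *\<^sub>C x)) = inner z (c *\<^sub>C B x)" for z
    proof -
      have "inner z (c *\<^sub>C B x) = inner (cnj c *\<^sub>C z) (B x)"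
        by (simp add: inner_scaleC_left)
      also have "\<dots> = inner (A (cnj c *\<^sub>C z)) x" by (rule AB)
      also have "\<dots> = inner z (B (c *\<^sub>C x))"
        by (simp add: bounded_clinearD[OF A] inner_scaleC_left AB)
      finally show ?thesis by simp
    qed
    then show "B (c *\<^sub>C x) = c *\<^sub>C B x" by (rule eqI)
  next
    fix x
    have "norm (B x) * norm (B x) = inner (A (B x)) x"
      by (simp flip: AB power2_norm_eq_inner power2_eq_square)
    also have "\<dots> \<le> norm (A (B x)) * norm x" by (rule norm_cauchy_schwarz)
    also have "\<dots> \<le> K * norm (B x) * norm x" using K by (simp add: mult_right_mono)
    finally have "norm (B x) * norm (B x) \<le> (K * norm x) * norm (B x)" by (simp add: mult_ac)
    then show "norm (B x) \<le> K * norm x"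
      using K by (cases "norm (B x) = 0") (auto simp: mult_le_cancel_right)
  qed
qed

lemma is_adjoint_cadjoint:
  fixes T :: "'a::complex_hilbert \<Rightarrow> 'a"
  assumes T: "bounded_clinear T"
  shows "is_adjoint T (cadjoint T)"
proof -
  have "\<exists>s. \<forall>x. inner (T x) y = inner x s" for y
    using riesz_representation_real
      [OF bounded_linear_compose[OF bounded_linear_inner_left bounded_clinearD(7)[OF T]]]
    by blast
  then obtain S where S: "\<And>x y. inner (T x) y = inner x (S y)" by metis
  have cS: "\<forall>x y. cinner (T x) y = cinner x (S y)"
    unfolding cinner_eq_inner by (simp flip: bounded_clinearD(5)[OF T] add: S)
  have "cadjoint T = S"
    unfolding cadjoint_def
  proof (rule the_equality)
    show "\<forall>x y. cinner (T x) y = cinner x (S y)" by (rule cS)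
  next
    fix S' assume S': "\<forall>x y. cinner (T x) y = cinner x (S' y)"
    show "S' = S"
    proof
      fix y
      have "inner x (S' y) = inner x (S y)" for x using cS S' by (simp add: inner_Re_cinner)
      then show "S' y = S y" by (blast intro: vector_eq_ldot[THEN iffD1])
    qed
  qed
  then show ?thesis using S by (simp add: is_adjoint_def)
qed

text \<open>The range is closed because the operator is bounded below, and nothing but \<open>0\<close> is orthogonal to it.\<close>

lemma bounded_below_imp_inverse:
  fixes C C' :: "'a::complex_hilbert \<Rightarrow> 'a"
  assumes C: "bounded_clinear C" and adj: "is_adjoint C C'" and e: "e > 0"
    and bb: "\<And>x. e * norm x \<le> norm (C x)" and bb': "\<And>x. e * norm x \<le> norm (C' x)"
  obtains S where "bounded_clinear S" "\<And>x. S (C x) = x" "\<And>x. C (S x) = x"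
proof -
  interpret C: bounded_linear C by (rule bounded_clinearD[OF C])
  have "complete (UNIV :: 'a set)" by (simp add: complete_eq_closed)
  then have "complete (range C)"
    by (intro complete_isometric_image[OF e subspace_UNIV C.bounded_linear]) (use bb in auto)
  then have cl: "closed (range C)" by (simp add: complete_eq_closed)
  have sub: "subspace (range C)" using linear_subspace_image[OF C.linear_axioms subspace_UNIV] by simp
  have surj: "y \<in> range C" for y
  proof (rule ccontr)
    assume "y \<notin> range C"
    then obtain w where w: "w \<noteq> 0" "\<And>u. u \<in> range C \<Longrightarrow> inner w u = 0"
      using exists_orthogonal_to_closed_subspace[OF sub cl] by metis
    have "inner (C' w) (C' w) = inner (C (C' w)) w"
      using adj by (simp add: is_adjoint_def)
    also have "\<dots> = 0" using w(2)[of "C (C' w)"] by (simp add: inner_commute)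
    finally have "C' w = 0" by simp
    then show False using bb'[of w] e w(1) by (simp add: mult_le_0_iff)
  qed
  have inj: "x = y" if "C x = C y" for x y
    using bb[of "x - y"] e that by (simp add: C.diff mult_le_0_iff)
  define S where "S = inv C"
  have CS: "C (S x) = x" for x unfolding S_def using surj by (simp add: f_inv_into_f)
  have SC: "S (C x) = x" for x by (rule inj) (rule CS)
  show ?thesis
  proof
    show "bounded_clinear S"
    proof (rule bounded_clinearI)
      show "S (x + y) = S x + S y" for x y by (rule inj) (simp add: CS C.add)
      show "S (c *\<^sub>C x) = c *\<^sub>C S x" for c x by (rule inj) (simp add: CS bounded_clinearD(5)[OF C])
      show "norm (S x) \<le> (1 / e) * norm x" for x
        using bb[of "S x"] e by (simp add: CS field_simps)
    qed
  qed (fact SC CS)+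
qed

section \<open>Polynomials of an operator\<close>

lemma poly_op_eq_sum:
  assumes "degree q \<le> n"
  shows "poly_op q A x = (\<Sum>i\<le>n. coeff q i *\<^sub>C (A ^^ i) x)"
  unfolding poly_op_def
  by (rule sum.mono_neutral_left) (use assms in \<open>auto simp: coeff_eq_0\<close>)

lemma poly_op_0 [simp]: "poly_op 0 A x = 0"
  by (simp add: poly_op_def)

lemma poly_op_add: "poly_op (p + q) A x = poly_op p A x + poly_op q A x"
proof -
  define n where "n = max (degree p) (degree q)"
  have "degree (p + q) \<le> n" "degree p \<le> n" "degree q \<le> n"
    by (auto simp: n_def degree_add_le_max)
  then show ?thesis
    by (simp add: poly_op_eq_sum[where n = n] scaleC_add_left sum.distrib)
qed

lemma poly_op_smult: "poly_op (smult c p) A x = c *\<^sub>C poly_op p A x"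
proof -
  have "poly_op (smult c p) A x = (\<Sum>i\<le>degree p. c *\<^sub>C (coeff p i *\<^sub>C (A ^^ i) x))"
    by (simp add: poly_op_eq_sum[OF degree_smult_le] scaleC_scaleC)
  also have "\<dots> = c *\<^sub>C poly_op p A x"
    unfolding poly_op_def
    by (rule linear_sum[OF bounded_linear.linear[OF bounded_linear_scaleC], symmetric])
  finally show ?thesis .
qed

lemma poly_op_diff: "poly_op (p - q) A x = poly_op p A x - poly_op q A x"
  using poly_op_add[of p "smult (-1) q" A x] poly_op_smult[of "-1" q A x]
  by (simp add: scaleC_one)

context
  fixes A :: "'a::complex_inner \<Rightarrow> 'a"
  assumes A: "bounded_clinear A"
begin

lemma poly_op_pCons: "poly_op (pCons a p) A x = a *\<^sub>C x + A (poly_op p A x)"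
proof -
  have lin: "linear A" using bounded_clinearD(7)[OF A] by (rule bounded_linear.linear)
  have "poly_op (pCons a p) A x = (\<Sum>i\<le>Suc (degree p). coeff (pCons a p) i *\<^sub>C (A ^^ i) x)"
    by (rule poly_op_eq_sum) (rule degree_pCons_le)
  also have "\<dots> = a *\<^sub>C x + (\<Sum>i\<le>degree p. coeff p i *\<^sub>C A ((A ^^ i) x))"
    by (simp add: sum.atMost_Suc_shift del: sum.atMost_Suc)
  also have "\<dots> = a *\<^sub>C x + A (poly_op p A x)"
    unfolding poly_op_def by (simp add: linear_sum[OF lin] bounded_clinearD(5)[OF A])
  finally show ?thesis .
qed

lemma poly_op_mult: "poly_op (p * q) A x = poly_op p A (poly_op q A x)"
  by (induction p) (simp_all add: poly_op_pCons poly_op_add poly_op_smult)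

lemma bounded_clinear_poly_op: "bounded_clinear (poly_op p A)"
proof (induction p)
  case 0
  show ?case using bounded_clinear_zero by (simp add: poly_op_0[abs_def])
next
  case (pCons a p)
  have "poly_op (pCons a p) A = (\<lambda>x. a *\<^sub>C x + A (poly_op p A x))"
    by (rule ext) (rule poly_op_pCons)
  then show ?case
    using bounded_clinear_add[OF bounded_clinear_scaleC bounded_clinear_comp[OF A pCons.IH]] by simp
qed

lemma poly_op_commute: "A (poly_op p A x) = poly_op p A (A x)"
proof -
  have "poly_op (p * [:0, 1:]) A x = poly_op ([:0, 1:] * p) A x" by (simp add: mult.commute)
  then show ?thesis unfolding poly_op_mult by (simp add: poly_op_pCons scaleC_one bounded_clinearD[OF A])
qed

lemma poly_op_eigenvector:
  assumes "A x = z *\<^sub>C x"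
  shows "poly_op p A x = poly p z *\<^sub>C x"
  by (induction p)
     (simp_all add: poly_op_pCons assms scaleC_add_left bounded_clinearD(5)[OF A] scaleC_scaleC mult.commute)

lemma is_adjoint_poly_op:
  assumes "is_adjoint A A"
  shows "is_adjoint (poly_op p A) (poly_op (map_poly cnj p) A)"
proof (induction p)
  case 0
  show ?case by (simp add: is_adjoint_def)
next
  case (pCons a p)
  have "map_poly cnj (pCons a p) = pCons (cnj a) (map_poly cnj p)"
    using pCons(1) by (simp add: map_poly_pCons)
  then show ?case
    using pCons.IH assms
    by (simp add: is_adjoint_def poly_op_pCons inner_add_left inner_add_right inner_scaleC_left poly_op_commute)
qed

end

section \<open>Spectral norm estimates on an invariant subspace\<close>

definition csubspace :: "'a::complex_inner set \<Rightarrow> bool" where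
  "csubspace W \<longleftrightarrow> 0 \<in> W \<and> (\<forall>x\<in>W. \<forall>y\<in>W. x + y \<in> W) \<and> (\<forall>c. \<forall>x\<in>W. c *\<^sub>C x \<in> W)"

lemma csubspace_scaleR: "csubspace W \<Longrightarrow> x \<in> W \<Longrightarrow> a *\<^sub>R x \<in> W"
  by (simp add: csubspace_def scaleR_scaleC)

lemma csubspace_UNIV: "csubspace UNIV"
  by (simp add: csubspace_def)

lemma poly_op_invariant:
  assumes A: "bounded_clinear A" and W: "csubspace W" "A ` W \<subseteq> W" and y: "y \<in> W"
  shows "poly_op p A y \<in> W"
  by (induction p) (use W y in \<open>auto simp: poly_op_pCons[OF A] csubspace_def\<close>)

definition bounded_below_on :: "'a::real_normed_vector set \<Rightarrow> ('a \<Rightarrow> 'a) \<Rightarrow> bool" where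
  "bounded_below_on W F \<longleftrightarrow> (\<exists>e>0. \<forall>y\<in>W. e * norm y \<le> norm (F y))"

text \<open>
  Over the complex numbers \<open>P\<close> splits into linear factors, and operators that are bounded below on the
  invariant subspace \<open>W\<close> may be composed there.
\<close>

lemma bounded_below_on_poly_op:
  assumes A: "bounded_clinear A" and W: "csubspace W" "A ` W \<subseteq> W"
    and "P \<noteq> 0" and "\<And>z. poly P z = 0 \<Longrightarrow> bounded_below_on W (\<lambda>x. A x - z *\<^sub>C x)"
  shows "bounded_below_on W (poly_op P A)"
  using assms(4,5)
proof (induction "degree P" arbitrary: P)
  case 0
  then obtain a where P: "P = [:a:]" by (metis degree_eq_zeroE)
  then have "norm (poly_op P A x) = cmod a * norm x" for x
    by (simp add: poly_op_pCons[OF A] bounded_clinearD[OF A])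
  then show ?case using 0 P unfolding bounded_below_on_def by (intro exI[of _ "cmod a"]) auto
next
  case (Suc n)
  have "\<not> constant (poly P)" using Suc(2) by (simp add: constant_degree)
  then obtain z where z: "poly P z = 0" using fundamental_theorem_of_algebra by blast
  then obtain Q where Q: "P = [:-z, 1:] * Q" by (auto simp: poly_eq_0_iff_dvd elim: dvdE)
  have Q0: "Q \<noteq> 0" using Q Suc.prems by auto
  then have "degree P = Suc (degree Q)" unfolding Q by (subst degree_mult_eq) auto
  then have "bounded_below_on W (poly_op Q A)"
    using Suc.hyps Suc.prems Q Q0 by (intro Suc.hyps(1)) auto
  then obtain e where e: "e > 0" "\<And>y. y \<in> W \<Longrightarrow> e * norm y \<le> norm (poly_op Q A y)"
    by (auto simp: bounded_below_on_def)
  obtain d where d: "d > 0" "\<And>y. y \<in> W \<Longrightarrow> d * norm y \<le> norm (A y - z *\<^sub>C y)"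
    using Suc.prems(2)[OF z] by (auto simp: bounded_below_on_def)
  have "(d * e) * norm y \<le> norm (poly_op P A y)" if "y \<in> W" for y
  proof -
    define u where "u = poly_op Q A y"
    have "(d * e) * norm y \<le> d * norm u" using e(2)[OF that] d(1) by (simp add: u_def)
    also have "\<dots> \<le> norm (A u - z *\<^sub>C u)"
      using d(2) poly_op_invariant[OF A W that] by (simp add: u_def)
    also have "A u - z *\<^sub>C u = poly_op P A y"
      unfolding Q poly_op_mult[OF A] u_def
      by (simp add: poly_op_pCons[OF A] scaleC_one bounded_clinearD[OF A])
    finally show ?thesis .
  qed
  then show ?case unfolding bounded_below_on_def using d e by (intro exI[of _ "d * e"]) auto
qed

lemma exists_least_bound_on:
  fixes F :: "'a::complex_inner \<Rightarrow> 'a"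
  assumes F: "bounded_clinear F"
  obtains \<nu> where "\<nu> \<ge> 0" "\<And>y. y \<in> W \<Longrightarrow> norm (F y) \<le> \<nu> * norm y"
    "\<And>\<kappa>. \<kappa> \<ge> 0 \<Longrightarrow> (\<And>y. y \<in> W \<Longrightarrow> norm (F y) \<le> \<kappa> * norm y) \<Longrightarrow> \<nu> \<le> \<kappa>"
proof -
  let ?S = "{\<kappa>. \<kappa> \<ge> 0 \<and> (\<forall>y\<in>W. norm (F y) \<le> \<kappa> * norm y)}"
  obtain K where K: "K > 0" "\<And>x. norm (F x) \<le> K * norm x" using bounded_clinear_bound[OF F] by blast
  then have ne: "?S \<noteq> {}" by (auto intro!: exI[of _ K])
  show ?thesis
  proof
    show "0 \<le> Inf ?S" by (rule cInf_greatest[OF ne]) auto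
  next
    fix y assume y: "y \<in> W"
    show "norm (F y) \<le> Inf ?S * norm y"
    proof (cases "y = 0")
      case True
      then show ?thesis by (simp add: bounded_clinearD[OF F])
    next
      case False
      have "norm (F y) / norm y \<le> Inf ?S"
        by (rule cInf_greatest[OF ne]) (use y False in \<open>auto simp: field_simps\<close>)
      then show ?thesis using False by (simp add: field_simps)
    qed
  next
    fix \<kappa> :: real assume "\<kappa> \<ge> 0" "\<And>y. y \<in> W \<Longrightarrow> norm (F y) \<le> \<kappa> * norm y"
    then show "Inf ?S \<le> \<kappa>" by (intro cInf_lower) (auto intro: bdd_belowI[of _ 0])
  qed
qed

text \<open>
  For self-adjoint \<open>A\<close> the vector \<open>(A - Re z) x\<close> is orthogonal, in the real inner product, to \<open>\<i> x\<close>. In particular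
  nonreal shifts are bounded below.
\<close>

lemma norm_shift_power2:
  fixes A :: "'a::complex_inner \<Rightarrow> 'a"
  assumes A: "bounded_clinear A" and sa: "is_adjoint A A"
  shows "(norm (A x - z *\<^sub>C x))\<^sup>2 = (norm (A x - Re z *\<^sub>R x))\<^sup>2 + (Im z)\<^sup>2 * (norm x)\<^sup>2"
proof -
  define u where "u = A x - Re z *\<^sub>R x"
  have z: "z *\<^sub>C x = Re z *\<^sub>R x + Im z *\<^sub>R (\<i> *\<^sub>C x)"
    by (subst complex_eq) (simp add: scaleC_add_left scaleR_scaleC scaleC_scaleC mult.commute)
  have 0: "inner x (\<i> *\<^sub>C x) = 0"
    using inner_scaleC_left[of \<i> x x] by (simp add: inner_commute)
  have "inner (A x) (\<i> *\<^sub>C x) = - inner (A (\<i> *\<^sub>C x)) x"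
    using inner_scaleC_left[of \<i> "A x" x] bounded_clinearD(5)[OF A]
    by (simp add: inner_scaleC_left)
  also have "\<dots> = - inner (A x) (\<i> *\<^sub>C x)"
    using sa[unfolded is_adjoint_def, rule_format, of "\<i> *\<^sub>C x" x] by (simp add: inner_commute)
  finally have 1: "inner u (\<i> *\<^sub>C x) = 0" by (simp add: u_def inner_diff_left 0)
  have "A x - z *\<^sub>C x = u - Im z *\<^sub>R (\<i> *\<^sub>C x)" by (simp add: z u_def)
  then show ?thesis by (simp add: norm_diff_scaleR_power2 1 u_def[symmetric])
qed

lemma bounded_below_on_shift_nonreal:
  assumes A: "bounded_clinear A" "is_adjoint A A" and "Im z \<noteq> 0"
  shows "bounded_below_on W (\<lambda>x. A x - z *\<^sub>C x)"
proof -
  have "\<bar>Im z\<bar> * norm x \<le> norm (A x - z *\<^sub>C x)" for x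
    by (rule power2_le_imp_le) (simp_all add: norm_shift_power2[OF A] power_mult_distrib)
  then show ?thesis unfolding bounded_below_on_def using assms(3) by (intro exI[of _ "\<bar>Im z\<bar>"]) auto
qed

lemma bounded_below_on_shift:
  assumes A: "bounded_clinear A" "is_adjoint A A"
    and W: "\<And>y. y \<in> W \<Longrightarrow> 0 \<le> inner (A y) y" "\<And>y. y \<in> W \<Longrightarrow> norm (A y) \<le> M * norm y"
    and z: "z \<notin> complex_of_real ` {0..M}"
  shows "bounded_below_on W (\<lambda>x. A x - z *\<^sub>C x)"
proof (cases "Im z = 0")
  case True
  define a where "a = Re z"
  have za: "z = complex_of_real a" using True by (simp add: a_def complex_eq_iff)
  then have "a < 0 \<or> a > M" using z by force
  then show ?thesis
  proof
    assume a: "a < 0"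
    have "- a * norm y \<le> norm (A y - z *\<^sub>C y)" if y: "y \<in> W" for y
    proof (cases "y = 0")
      case False
      have "- a * norm y * norm y \<le> inner (A y - z *\<^sub>C y) y"
        using W(1)[OF y]
        by (simp add: za scaleR_scaleC[symmetric] inner_diff_left power2_norm_eq_inner[symmetric] power2_eq_square)
      also have "\<dots> \<le> norm (A y - z *\<^sub>C y) * norm y" by (rule norm_cauchy_schwarz)
      finally show ?thesis by (rule mult_right_le_imp_le) (use False in simp)
    qed (simp add: bounded_clinearD[OF A(1)])
    then show ?thesis unfolding bounded_below_on_def using a by (intro exI[of _ "- a"]) auto
  next
    assume a: "a > M"
    have "(a - M) * norm y \<le> norm (A y - z *\<^sub>C y)" if y: "y \<in> W" for y
    proof -
      have "a * norm y \<le> norm (a *\<^sub>R y)" by (simp add: mult_right_mono)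
      also have "\<dots> \<le> norm (A y) + norm (A y - a *\<^sub>R y)"
        by (metis add.commute norm_minus_commute norm_triangle_sub)
      also have "\<dots> \<le> M * norm y + norm (A y - z *\<^sub>C y)" using W(2)[OF y] by (simp add: za scaleR_scaleC)
      finally show ?thesis by (simp add: algebra_simps)
    qed
    then show ?thesis unfolding bounded_below_on_def using a by (intro exI[of _ "a - M"]) auto
  qed
qed (use A bounded_below_on_shift_nonreal in blast)

text \<open>Polynomials of a self-adjoint operator commute with their adjoints.\<close>

lemma norm_poly_op_cnj:
  assumes A: "bounded_clinear A" and sa: "is_adjoint A A"
  shows "norm (poly_op (map_poly cnj q) A w) = norm (poly_op q A w)"
proof -
  let ?q' = "map_poly cnj q"
  note adj = is_adjoint_poly_op[OF A sa, of q, unfolded is_adjoint_def, rule_format]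
  have "(norm (poly_op ?q' A w))\<^sup>2 = inner (poly_op (q * ?q') A w) w"
    unfolding power2_norm_eq_inner by (simp add: poly_op_mult[OF A] adj)
  also have "\<dots> = inner (poly_op (?q' * q) A w) w" by (simp add: mult.commute)
  also have "\<dots> = (norm (poly_op q A w))\<^sup>2"
    unfolding power2_norm_eq_inner by (simp add: poly_op_mult[OF A] adj inner_commute)
  finally show ?thesis by (simp add: power2_eq_iff_nonneg)
qed

context
  fixes A :: "'a::complex_inner \<Rightarrow> 'a" and W :: "'a set"
  assumes A: "bounded_clinear A" and sa: "is_adjoint A A"
    and W: "csubspace W" "A ` W \<subseteq> W"
begin

text \<open>
  Let \<open>q\<^sup>*\<close> be \<open>q\<close> with conjugate coefficients, so that \<open>q\<^sup>*(A)\<close> is the adjoint of \<open>Q = q(A)\<close>. With \<open>\<nu>\<close> the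
  norm of \<open>Q\<close> on \<open>W\<close>, every \<open>y \<in> W\<close> satisfies
  \<open>\<parallel>(\<nu>\<^sup>2 - Q\<^sup>* Q) y\<parallel>\<^sup>2 \<le> \<nu>\<^sup>2 (\<nu>\<^sup>2 \<parallel>y\<parallel>\<^sup>2 - \<parallel>Q y\<parallel>\<^sup>2)\<close>, and the right-hand side is arbitrarily small for unit
  vectors that almost attain the norm. So the polynomial \<open>\<nu>\<^sup>2 - q\<^sup>* q\<close> of \<open>A\<close> is not bounded below on
  \<open>W\<close>, and by the factorization over the complex numbers neither is \<open>A - z\<close> for one of its roots \<open>z\<close>.
\<close>

lemma least_bound_attained:
  assumes nu: "\<nu> > 0" "\<And>y. y \<in> W \<Longrightarrow> norm (poly_op q A y) \<le> \<nu> * norm y"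
    and least: "\<And>\<kappa>. \<kappa> \<ge> 0 \<Longrightarrow> (\<And>y. y \<in> W \<Longrightarrow> norm (poly_op q A y) \<le> \<kappa> * norm y) \<Longrightarrow> \<nu> \<le> \<kappa>"
    and nz: "[:complex_of_real (\<nu>\<^sup>2):] - map_poly cnj q * q \<noteq> 0"
  obtains z where "\<not> bounded_below_on W (\<lambda>x. A x - z *\<^sub>C x)" "cmod (poly q z) = \<nu>"
proof -
  let ?P = "[:complex_of_real (\<nu>\<^sup>2):] - map_poly cnj q * q"
  have "\<not> bounded_below_on W (poly_op ?P A)"
  proof
    assume "bounded_below_on W (poly_op ?P A)"
    then obtain e where e: "e > 0" "\<And>y. y \<in> W \<Longrightarrow> e * norm y \<le> norm (poly_op ?P A y)"
      by (auto simp: bounded_below_on_def)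
    define \<kappa> where "\<kappa> = sqrt (max 0 (\<nu>\<^sup>2 - e\<^sup>2 / \<nu>\<^sup>2))"
    have "norm (poly_op q A y) \<le> \<kappa> * norm y" if y: "y \<in> W" for y
    proof -
      define w where "w = poly_op q A y"
      define v where "v = poly_op (map_poly cnj q) A w"
      have wW: "w \<in> W" using poly_op_invariant[OF A W y] by (simp add: w_def)
      have vw: "(norm v)\<^sup>2 \<le> \<nu>\<^sup>2 * (norm w)\<^sup>2"
        using nu(2)[OF wW] norm_poly_op_cnj[OF A sa, of q w]
        by (simp add: v_def power_mult_distrib[symmetric] power_mono)
      have vy: "inner v y = (norm w)\<^sup>2"
        using is_adjoint_sym[OF is_adjoint_poly_op[OF A sa, of q]]
        by (simp add: v_def w_def is_adjoint_def power2_norm_eq_inner)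
      have "poly_op ?P A y = - (v - (\<nu>\<^sup>2) *\<^sub>R y)"
        by (simp add: poly_op_diff poly_op_mult[OF A] v_def w_def poly_op_pCons[OF A]
            scaleR_scaleC bounded_clinearD[OF A])
      then have "norm (poly_op ?P A y) = norm (v - (\<nu>\<^sup>2) *\<^sub>R y)" by (simp only: norm_minus_cancel)
      then have "(norm (poly_op ?P A y))\<^sup>2 = (norm v)\<^sup>2 - 2 * \<nu>\<^sup>2 * (norm w)\<^sup>2 + (\<nu>\<^sup>2)\<^sup>2 * (norm y)\<^sup>2"
        by (simp only: norm_diff_scaleR_power2 vy)
      moreover have "(e * norm y)\<^sup>2 \<le> (norm (poly_op ?P A y))\<^sup>2"
        using e(2)[OF y] e(1) by (intro power_mono) auto
      ultimately have "e\<^sup>2 * (norm y)\<^sup>2 \<le> \<nu>\<^sup>2 * (\<nu>\<^sup>2 * (norm y)\<^sup>2 - (norm w)\<^sup>2)"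
        using vw by (simp add: power_mult_distrib algebra_simps power2_eq_square)
      then have "(norm w)\<^sup>2 \<le> (\<nu>\<^sup>2 - e\<^sup>2 / \<nu>\<^sup>2) * (norm y)\<^sup>2"
        using nu(1) by (simp add: field_simps)
      also have "\<dots> \<le> max 0 (\<nu>\<^sup>2 - e\<^sup>2 / \<nu>\<^sup>2) * (norm y)\<^sup>2" by (intro mult_right_mono) auto
      also have "\<dots> = (\<kappa> * norm y)\<^sup>2" by (simp add: \<kappa>_def power_mult_distrib)
      finally show ?thesis unfolding w_def[symmetric]
        by (rule power2_le_imp_le) (simp add: \<kappa>_def)
    qed
    then have "\<nu> \<le> \<kappa>" by (intro least) (simp_all add: \<kappa>_def)
    then have "\<nu>\<^sup>2 \<le> max 0 (\<nu>\<^sup>2 - e\<^sup>2 / \<nu>\<^sup>2)" using nu(1) power_mono[of \<nu> \<kappa> 2] by (simp add: \<kappa>_def)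
    moreover have "e\<^sup>2 / \<nu>\<^sup>2 > 0" "\<nu>\<^sup>2 > 0" using e(1) nu(1) by simp_all
    ultimately show False by linarith
  qed
  then obtain z where z: "poly ?P z = 0" "\<not> bounded_below_on W (\<lambda>x. A x - z *\<^sub>C x)"
    using bounded_below_on_poly_op[OF A W nz] by blast
  have "Im z = 0" using bounded_below_on_shift_nonreal[OF A sa] z(2) by blast
  then have zr: "cnj z = z" by (simp add: complex_eq_iff)
  have "complex_of_real (\<nu>\<^sup>2) = cnj (poly q z) * poly q z"
    using z(1) zr by simp
  then have "complex_of_real (\<nu>\<^sup>2) = complex_of_real ((cmod (poly q z))\<^sup>2)"
    using complex_norm_square[of "poly q z"] by (simp add: mult.commute)
  then have "\<nu>\<^sup>2 = (cmod (poly q z))\<^sup>2" by (simp only: of_real_eq_iff)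
  then have "cmod (poly q z) = \<nu>" using nu(1) by (simp add: power2_eq_iff_nonneg)
  with z(2) show ?thesis by (rule that)
qed

text \<open>
  With \<open>q\<close> the identity polynomial, \<open>\<nu>\<^sup>2 - q\<^sup>* q = \<nu>\<^sup>2 - X\<^sup>2\<close> is never the zero polynomial, so the norm is attained
  at a point of the approximate point spectrum.
\<close>

lemma approximate_point_spectrum_nonempty:
  assumes "\<not> W \<subseteq> {0}"
  obtains z where "\<not> bounded_below_on W (\<lambda>x. A x - z *\<^sub>C x)"
proof -
  have AX: "poly_op [:0, 1:] A = A"
    by (rule ext) (simp add: poly_op_pCons[OF A] scaleC_one bounded_clinearD[OF A])
  obtain \<nu> where nu: "\<nu> \<ge> 0" "\<And>y. y \<in> W \<Longrightarrow> norm (A y) \<le> \<nu> * norm y"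
    "\<And>\<kappa>. \<kappa> \<ge> 0 \<Longrightarrow> (\<And>y. y \<in> W \<Longrightarrow> norm (A y) \<le> \<kappa> * norm y) \<Longrightarrow> \<nu> \<le> \<kappa>"
    using exists_least_bound_on[OF A] by metis
  show ?thesis
  proof (cases "\<nu> = 0")
    case True
    obtain y where y: "y \<in> W" "y \<noteq> 0" using assms by auto
    have "A y = 0" using nu(2)[OF y(1)] True by simp
    then have "\<not> bounded_below_on W (\<lambda>x. A x - 0 *\<^sub>C x)"
      using y by (auto simp: bounded_below_on_def not_le intro!: bexI[of _ y])
    then show ?thesis by (rule that)
  next
    case False
    have "[:complex_of_real (\<nu>\<^sup>2):] - map_poly cnj [:0, 1:] * [:0, 1:] \<noteq> 0"
      by (simp add: map_poly_pCons)
    then show ?thesis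
      using least_bound_attained[of \<nu> "[:0, 1:]", unfolded AX] nu False that by (metis less_eq_real_def)
  qed
qed

text \<open>
  If \<open>\<nu>\<^sup>2 - q\<^sup>* q\<close> is the zero polynomial, then \<open>|q| = \<nu>\<close> at every real point, and any point of the approximate
  point spectrum will do.
\<close>

lemma norm_poly_op_le:
  assumes c: "c \<ge> 0" "\<And>z. \<not> bounded_below_on W (\<lambda>x. A x - z *\<^sub>C x) \<Longrightarrow> cmod (poly q z) \<le> c"
    and y: "y \<in> W"
  shows "norm (poly_op q A y) \<le> c * norm y"
proof -
  have Q: "bounded_clinear (poly_op q A)" by (rule bounded_clinear_poly_op[OF A])
  obtain \<nu> where nu: "\<nu> \<ge> 0" "\<And>y. y \<in> W \<Longrightarrow> norm (poly_op q A y) \<le> \<nu> * norm y"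
    "\<And>\<kappa>. \<kappa> \<ge> 0 \<Longrightarrow> (\<And>y. y \<in> W \<Longrightarrow> norm (poly_op q A y) \<le> \<kappa> * norm y) \<Longrightarrow> \<nu> \<le> \<kappa>"
    using exists_least_bound_on[OF Q] by metis
  have "\<nu> \<le> c"
  proof (cases "\<nu> = 0 \<or> W \<subseteq> {0}")
    case True
    then show ?thesis
    proof
      assume "W \<subseteq> {0}"
      then have "\<nu> \<le> 0" by (intro nu(3)) (auto simp: bounded_clinearD[OF Q])
      then show ?thesis using c(1) by simp
    qed (use c in simp)
  next
    case False
    show ?thesis
    proof (cases "[:complex_of_real (\<nu>\<^sup>2):] - map_poly cnj q * q = 0")
      case True
      obtain z where z: "\<not> bounded_below_on W (\<lambda>x. A x - z *\<^sub>C x)"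
        using approximate_point_spectrum_nonempty False by blast
      have "Im z = 0" using bounded_below_on_shift_nonreal[OF A sa] z by blast
      then have zr: "cnj z = z" by (simp add: complex_eq_iff)
      have "poly ([:complex_of_real (\<nu>\<^sup>2):] - map_poly cnj q * q) z = 0" using True by simp
      then have "complex_of_real (\<nu>\<^sup>2) = cnj (poly q z) * poly q z"
        using zr by simp
      then have "complex_of_real (\<nu>\<^sup>2) = complex_of_real ((cmod (poly q z))\<^sup>2)"
        using complex_norm_square[of "poly q z"] by (simp add: mult.commute)
      then have "\<nu>\<^sup>2 = (cmod (poly q z))\<^sup>2" by (simp only: of_real_eq_iff)
      then have "cmod (poly q z) = \<nu>" using nu(1) by (simp add: power2_eq_iff_nonneg)
      then show ?thesis using c(2)[OF z] by simp
    next
      case nz: False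
      show ?thesis
      proof (rule least_bound_attained[OF _ nu(2,3) nz])
        show "\<nu> > 0" using False nu(1) by simp
      qed (use c(2) in auto)
    qed
  qed
  then show ?thesis using nu(2)[OF y] by (meson mult_right_mono norm_ge_zero order_trans)
qed

end

text \<open>
  Outside the interval both \<open>A - z\<close> and its adjoint \<open>A - cnj z\<close> are bounded below, which makes \<open>A - z\<close> invertible.
\<close>

lemma spectrum_subset:
  fixes A :: "'a::complex_hilbert \<Rightarrow> 'a"
  assumes A: "bounded_clinear A" "is_adjoint A A"
    and pos: "\<And>x. 0 \<le> inner (A x) x" and M: "\<And>x. norm (A x) \<le> M * norm x"
  shows "spectrum_op A \<subseteq> complex_of_real ` {0..M}"
proof
  fix z assume z: "z \<in> spectrum_op A"
  show "z \<in> complex_of_real ` {0..M}"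
  proof (rule ccontr)
    assume nz: "z \<notin> complex_of_real ` {0..M}"
    then have nz': "cnj z \<notin> complex_of_real ` {0..M}"
      by (metis (no_types, lifting) complex_cnj_cnj complex_cnj_complex_of_real image_iff)
    obtain d where d: "d > 0" "\<And>y. d * norm y \<le> norm (A y - z *\<^sub>C y)"
      using bounded_below_on_shift[OF A _ _ nz, of UNIV] pos M by (auto simp: bounded_below_on_def)
    obtain d' where d': "d' > 0" "\<And>y. d' * norm y \<le> norm (A y - cnj z *\<^sub>C y)"
      using bounded_below_on_shift[OF A _ _ nz', of UNIV] pos M by (auto simp: bounded_below_on_def)
    have e: "min d d' > 0" using d d' by simp
    have bb: "min d d' * norm y \<le> norm (A y - z *\<^sub>C y)" "min d d' * norm y \<le> norm (A y - cnj z *\<^sub>C y)" for y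
      using d(2)[of y] d'(2)[of y] mult_right_mono[of "min d d'" d "norm y"]
        mult_right_mono[of "min d d'" d' "norm y"] by auto
    have adj: "is_adjoint (\<lambda>x. A x - z *\<^sub>C x) (\<lambda>x. A x - cnj z *\<^sub>C x)"
      using A(2) by (simp add: is_adjoint_def inner_diff_left inner_diff_right inner_scaleC_left)
    obtain S where "bounded_clinear S" "\<And>x. S (A x - z *\<^sub>C x) = x" "\<And>x. A (S x) - z *\<^sub>C S x = x"
      using bounded_below_imp_inverse[OF bounded_clinear_diff[OF A(1) bounded_clinear_scaleC] adj e bb]
      by metis
    then show False using z by (auto simp: spectrum_op_def)
  qed
qed

lemma not_bounded_below_imp_spectrum:
  assumes "\<not> bounded_below_on UNIV (\<lambda>x. A x - z *\<^sub>C x)"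
  shows "z \<in> spectrum_op A"
proof (rule ccontr)
  assume "z \<notin> spectrum_op A"
  then obtain S where S: "bounded_clinear S" "\<And>x. S (A x - z *\<^sub>C x) = x"
    by (auto simp: spectrum_op_def)
  obtain K where K: "K > 0" "\<And>x. norm (S x) \<le> K * norm x" using bounded_clinear_bound[OF S(1)] by blast
  have "(1 / K) * norm x \<le> norm (A x - z *\<^sub>C x)" for x
    using K(2)[of "A x - z *\<^sub>C x"] K(1) by (simp add: S(2) field_simps)
  then show False using assms K(1) unfolding bounded_below_on_def by (metis UNIV_I zero_less_divide_1_iff)
qed

lemma norm_poly_op_le_spectrum:
  assumes A: "bounded_clinear A" "is_adjoint A A" and "c \<ge> 0"
    and "\<And>z. z \<in> spectrum_op A \<Longrightarrow> cmod (poly q z) \<le> c"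
  shows "norm (poly_op q A x) \<le> c * norm x"
  by (rule norm_poly_op_le[OF A csubspace_UNIV]) (use assms not_bounded_below_imp_spectrum in auto)

section \<open>Existence of the functional calculus\<close>

text \<open>
  Convergence in operator norm, stated without suprema so that it can be applied to individual vectors.
\<close>

definition op_limit :: "(nat \<Rightarrow> complex poly) \<Rightarrow> ('a::complex_inner \<Rightarrow> 'a) \<Rightarrow> ('a \<Rightarrow> 'a) \<Rightarrow> bool" where
  "op_limit q A S \<longleftrightarrow>
     (\<forall>e>0. \<forall>\<^sub>F n in sequentially. \<forall>x. norm (poly_op (q n) A x - S x) \<le> e * norm x)"

lemma op_limit_tendsto:
  assumes "op_limit q A S"
  shows "(\<lambda>n. poly_op (q n) A x) \<longlonglongrightarrow> S x"
proof (rule tendstoI)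
  fix e :: real assume e: "e > 0"
  define d where "d = e / (2 * (norm x + 1))"
  have d: "d > 0" using e by (simp add: d_def add_nonneg_pos)
  have "d * norm x \<le> d * (norm x + 1)" using d by simp
  also have "\<dots> = e / 2" by (simp add: d_def add_nonneg_eq_0_iff field_simps)
  finally have dx: "d * norm x < e" using e by simp
  have "\<forall>\<^sub>F n in sequentially. \<forall>x. norm (poly_op (q n) A x - S x) \<le> d * norm x"
    using assms d by (simp add: op_limit_def)
  then show "\<forall>\<^sub>F n in sequentially. dist (poly_op (q n) A x) (S x) < e"
  proof (rule eventually_mono)
    fix n assume "\<forall>x. norm (poly_op (q n) A x - S x) \<le> d * norm x"
    then show "dist (poly_op (q n) A x) (S x) < e" using dx by (auto simp: dist_norm intro: le_less_trans)
  qed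
qed

lemma op_limit_iff_onorm:
  assumes A: "bounded_clinear A" and S: "bounded_clinear S"
  shows "op_limit q A S \<longleftrightarrow> (\<lambda>n. onorm (\<lambda>x. poly_op (q n) A x - S x)) \<longlonglongrightarrow> 0"
proof -
  have bl: "bounded_linear (\<lambda>x. poly_op (q n) A x - S x)" for n
    using bounded_clinear_diff[OF bounded_clinear_poly_op[OF A] S] by (rule bounded_clinearD)
  show ?thesis
  proof
    assume L: "op_limit q A S"
    show "(\<lambda>n. onorm (\<lambda>x. poly_op (q n) A x - S x)) \<longlonglongrightarrow> 0"
    proof (rule tendstoI)
      fix e :: real assume e: "e > 0"
      have "\<forall>\<^sub>F n in sequentially. \<forall>x. norm (poly_op (q n) A x - S x) \<le> (e / 2) * norm x"
        using L e unfolding op_limit_def by (meson half_gt_zero)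
      then show "\<forall>\<^sub>F n in sequentially. dist (onorm (\<lambda>x. poly_op (q n) A x - S x)) 0 < e"
      proof (rule eventually_mono)
        fix n assume "\<forall>x. norm (poly_op (q n) A x - S x) \<le> (e / 2) * norm x"
        then have "onorm (\<lambda>x. poly_op (q n) A x - S x) \<le> e / 2"
          using e by (intro onorm_bound) auto
        then show "dist (onorm (\<lambda>x. poly_op (q n) A x - S x)) 0 < e"
          using onorm_pos_le[OF bl[of n]] e by simp
      qed
    qed
  next
    assume L: "(\<lambda>n. onorm (\<lambda>x. poly_op (q n) A x - S x)) \<longlonglongrightarrow> 0"
    show "op_limit q A S"
      unfolding op_limit_def
    proof (intro allI impI)
      fix e :: real assume "e > 0"
      then have "\<forall>\<^sub>F n in sequentially. onorm (\<lambda>x. poly_op (q n) A x - S x) < e"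
        using order_tendstoD(2)[OF L] by blast
      then show "\<forall>\<^sub>F n in sequentially. \<forall>x. norm (poly_op (q n) A x - S x) \<le> e * norm x"
      proof (rule eventually_mono)
        fix n assume n: "onorm (\<lambda>x. poly_op (q n) A x - S x) < e"
        show "\<forall>x. norm (poly_op (q n) A x - S x) \<le> e * norm x"
          using onorm[OF bl[of n]] n by (meson less_imp_le mult_right_mono norm_ge_zero order_trans)
      qed
    qed
  qed
qed

text \<open>
  Polynomials that are uniformly close on the spectrum give operators that are close in norm, so
  uniform convergence on the spectrum passes to the operators, with a limit that is the same for
  all approximating sequences.
\<close>

lemma fun_calc_limit:
  fixes A :: "'a::complex_hilbert \<Rightarrow> 'a"
  assumes A: "bounded_clinear A" "is_adjoint A A"
    and q0: "uniform_limit (spectrum_op A) (\<lambda>n. poly (q0 n)) f sequentially"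
  shows "bounded_clinear (fun_calc f A)"
    and "uniform_limit (spectrum_op A) (\<lambda>n. poly (q n)) f sequentially \<Longrightarrow> op_limit q A (fun_calc f A)"
proof -
  have close: "norm (poly_op p A x - poly_op q A x) \<le> (c + d) * norm x"
    if p: "\<And>z. z \<in> spectrum_op A \<Longrightarrow> dist (poly p z) (f z) < c"
      and q: "\<And>z. z \<in> spectrum_op A \<Longrightarrow> dist (poly q z) (f z) < d" and cd: "c > 0" "d > 0" for p q c d x
  proof -
    have "cmod (poly (p - q) z) \<le> c + d" if z: "z \<in> spectrum_op A" for z
      using norm_triangle_ineq4[of "poly p z - f z" "poly q z - f z"] p[OF z] q[OF z]
      by (simp add: dist_norm)
    then show ?thesis
      using norm_poly_op_le_spectrum[OF A, of "c + d" "p - q" x] cd by (simp add: poly_op_diff)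
  qed
  have ev: "\<exists>N. \<forall>n\<ge>N. \<forall>z\<in>spectrum_op A. dist (poly (q n) z) (f z) < e"
    if "uniform_limit (spectrum_op A) (\<lambda>n. poly (q n)) f sequentially" "e > 0" for q e
    using uniform_limitD[OF that] by (simp add: eventually_sequentially)
  have "Cauchy (\<lambda>n. poly_op (q0 n) A x)" for x
  proof (rule metric_CauchyI)
    fix e :: real assume e: "e > 0"
    define d where "d = e / (4 * (norm x + 1))"
    have d: "d > 0" using e by (simp add: d_def add_nonneg_pos)
    have "(d + d) * norm x \<le> (d + d) * (norm x + 1)" using d by simp
    also have "\<dots> = e / 2" by (simp add: d_def add_nonneg_eq_0_iff field_simps)
    finally have dx: "(d + d) * norm x < e" using e by simp
    obtain N where "\<forall>n\<ge>N. \<forall>z\<in>spectrum_op A. dist (poly (q0 n) z) (f z) < d"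
      using ev[OF q0 d] by blast
    then have "dist (poly_op (q0 m) A x) (poly_op (q0 n) A x) < e" if "m \<ge> N" "n \<ge> N" for m n
      using close[of "q0 m" d "q0 n" d x] that d dx by (simp add: dist_norm)
    then show "\<exists>N. \<forall>m\<ge>N. \<forall>n\<ge>N. dist (poly_op (q0 m) A x) (poly_op (q0 n) A x) < e" by blast
  qed
  then have "\<exists>l. (\<lambda>n. poly_op (q0 n) A x) \<longlonglongrightarrow> l" for x
    using Cauchy_convergent convergent_def by blast
  then obtain S where S: "\<And>x. (\<lambda>n. poly_op (q0 n) A x) \<longlonglongrightarrow> S x" by metis
  have lim: "op_limit q A S"
    if q: "uniform_limit (spectrum_op A) (\<lambda>n. poly (q n)) f sequentially" for q
    unfolding op_limit_def
  proof (intro allI impI)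
    fix e :: real assume e: "e > 0"
    obtain N where N: "\<forall>n\<ge>N. \<forall>z\<in>spectrum_op A. dist (poly (q n) z) (f z) < e / 2"
      using ev[OF q, of "e/2"] e by auto
    obtain N0 where N0: "\<forall>n\<ge>N0. \<forall>z\<in>spectrum_op A. dist (poly (q0 n) z) (f z) < e / 2"
      using ev[OF q0, of "e/2"] e by auto
    have "norm (poly_op (q n) A x - S x) \<le> e * norm x" if n: "n \<ge> N" for n x
    proof (rule tendsto_upperbound)
      show "(\<lambda>m. norm (poly_op (q n) A x - poly_op (q0 m) A x)) \<longlonglongrightarrow> norm (poly_op (q n) A x - S x)"
        by (intro tendsto_intros S)
      show "\<forall>\<^sub>F m in sequentially. norm (poly_op (q n) A x - poly_op (q0 m) A x) \<le> e * norm x"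
        unfolding eventually_sequentially
        using close[of "q n" "e/2" "q0 _" "e/2" x] N N0 n e by (intro exI[of _ N0]) simp
    qed simp
    then show "\<forall>\<^sub>F n in sequentially. \<forall>x. norm (poly_op (q n) A x - S x) \<le> e * norm x"
      unfolding eventually_sequentially by blast
  qed
  have bS: "bounded_clinear S"
  proof -
    have P: "bounded_clinear (poly_op (q0 n) A)" for n by (rule bounded_clinear_poly_op[OF A(1)])
    obtain n where n: "\<And>x. norm (poly_op (q0 n) A x - S x) \<le> 1 * norm x"
      using lim[OF q0] unfolding op_limit_def eventually_sequentially by (metis order_refl zero_less_one)
    obtain K where K: "\<And>x. norm (poly_op (q0 n) A x) \<le> K * norm x" using bounded_clinear_bound[OF P] by blast
    show ?thesis
    proof (rule bounded_clinearI)
      fix x y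
      have "(\<lambda>n. poly_op (q0 n) A (x + y)) \<longlonglongrightarrow> S x + S y"
        unfolding bounded_clinearD(1)[OF P] by (intro tendsto_intros S)
      then show "S (x + y) = S x + S y" using S LIMSEQ_unique by blast
    next
      fix c x
      have "(\<lambda>n. poly_op (q0 n) A (c *\<^sub>C x)) \<longlonglongrightarrow> c *\<^sub>C S x"
        unfolding bounded_clinearD(5)[OF P] by (rule bounded_linear.tendsto[OF bounded_linear_scaleC S])
      then show "S (c *\<^sub>C x) = c *\<^sub>C S x" using S LIMSEQ_unique by blast
    next
      fix x
      have "norm (S x) \<le> norm (poly_op (q0 n) A x) + norm (poly_op (q0 n) A x - S x)"
        by (metis norm_minus_commute norm_triangle_sub)
      also have "\<dots> \<le> (K + 1) * norm x" using n[of x] K[of x] by (simp add: algebra_simps)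
      finally show "norm (S x) \<le> (K + 1) * norm x" .
    qed
  qed
  have "fun_calc f A = S"
    unfolding fun_calc_def
  proof (rule the_equality)
    show "bounded_clinear S \<and> (\<forall>q. uniform_limit (spectrum_op A) (\<lambda>n. poly (q n)) f sequentially \<longrightarrow>
        (\<lambda>n. onorm (\<lambda>x. poly_op (q n) A x - S x)) \<longlonglongrightarrow> 0)"
      using bS lim op_limit_iff_onorm[OF A(1) bS] by blast
  next
    fix S' assume S': "bounded_clinear S' \<and> (\<forall>q. uniform_limit (spectrum_op A) (\<lambda>n. poly (q n)) f sequentially \<longrightarrow>
        (\<lambda>n. onorm (\<lambda>x. poly_op (q n) A x - S' x)) \<longlonglongrightarrow> 0)"
    then have "op_limit q0 A S'" using q0 op_limit_iff_onorm[OF A(1)] by blast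
    then show "S' = S" using op_limit_tendsto S LIMSEQ_unique by blast
  qed
  then show "bounded_clinear (fun_calc f A)"
    "uniform_limit (spectrum_op A) (\<lambda>n. poly (q n)) f sequentially \<Longrightarrow> op_limit q A (fun_calc f A)"
    using bS lim by auto
qed

section \<open>Powers of positive operators\<close>

definition pos_op :: "('a::complex_inner \<Rightarrow> 'a) \<Rightarrow> bool" where
  "pos_op A \<longleftrightarrow> bounded_clinear A \<and> is_adjoint A A \<and> (\<forall>x. 0 \<le> inner (A x) x)"

lemma pos_opD:
  assumes "pos_op A"
  shows "bounded_clinear A" "is_adjoint A A" "0 \<le> inner (A x) x"
  using assms by (auto simp: pos_op_def)

abbreviation cpowr :: "real \<Rightarrow> complex \<Rightarrow> complex" where
  "cpowr s z \<equiv> complex_of_real (Re z powr s)"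

text \<open>
  Weierstrass approximation, corrected by a constant. The vanishing at \<open>0\<close> is what lets compactness
  pass to powers later on.
\<close>

lemma powr_uniform_limit_poly:
  assumes "s > 0" "M \<ge> 0"
  obtains q where "uniform_limit (complex_of_real ` {0..M}) (\<lambda>n. poly (q n)) (cpowr s) sequentially"
    and "\<And>n. poly (q n) 0 = 0"
proof -
  have cont: "continuous_on {0..M} (\<lambda>t. t powr s)"
    by (rule continuous_on_powr') (use assms in \<open>auto intro: continuous_intros\<close>)
  have "\<exists>q. poly q 0 = 0 \<and> (\<forall>t\<in>{0..M}. cmod (poly q (complex_of_real t) - complex_of_real (t powr s))
      < 2 * inverse (real (Suc n)))" for n
  proof -
    obtain g where g: "real_polynomial_function g" "\<And>t. t \<in> {0..M} \<Longrightarrow> \<bar>t powr s - g t\<bar> < inverse (real (Suc n))"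
      using Stone_Weierstrass_real_polynomial_function[OF compact_Icc cont, of "inverse (real (Suc n))"]
      by auto
    obtain a m where am: "g = (\<lambda>x. \<Sum>i\<le>m. a i * x ^ i)"
      using g(1) unfolding real_polynomial_function_iff_sum by blast
    define p where "p = (\<Sum>i\<le>m. monom (complex_of_real (a i)) i)"
    have p: "poly p (complex_of_real t) = complex_of_real (g t)" for t
      by (simp add: p_def am poly_sum poly_monom)
    have "cmod (poly (p - [:poly p 0:]) (complex_of_real t) - complex_of_real (t powr s))
        < 2 * inverse (real (Suc n))" if t: "t \<in> {0..M}" for t
    proof -
      have "poly (p - [:poly p 0:]) (complex_of_real t) - complex_of_real (t powr s)
          = complex_of_real (g t - g 0 - t powr s)"
        using p[of 0] by (simp add: p)
      then have "cmod (poly (p - [:poly p 0:]) (complex_of_real t) - complex_of_real (t powr s))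
          = \<bar>g t - g 0 - t powr s\<bar>"
        by (simp only: norm_of_real)
      then show ?thesis using g(2)[OF t] g(2)[of 0] assms by auto
    qed
    then show ?thesis by (intro exI[of _ "p - [:poly p 0:]"]) simp
  qed
  then obtain q where q: "\<And>n. poly (q n) 0 = 0"
    "\<And>n t. t \<in> {0..M} \<Longrightarrow> cmod (poly (q n) (complex_of_real t) - complex_of_real (t powr s))
      < 2 * inverse (real (Suc n))"
    by metis
  have "uniform_limit (complex_of_real ` {0..M}) (\<lambda>n. poly (q n)) (cpowr s) sequentially"
  proof (rule uniform_limitI)
    fix e :: real assume e: "e > 0"
    have "\<forall>\<^sub>F n in sequentially. inverse (real (Suc n)) < e / 2"
      by (rule order_tendstoD(2)[OF LIMSEQ_inverse_real_of_nat]) (use e in simp)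
    then show "\<forall>\<^sub>F n in sequentially. \<forall>z\<in>complex_of_real ` {0..M}. dist (poly (q n) z) (cpowr s z) < e"
    proof (rule eventually_mono)
      fix n assume n: "inverse (real (Suc n)) < e / 2"
      show "\<forall>z\<in>complex_of_real ` {0..M}. dist (poly (q n) z) (cpowr s z) < e"
      proof
        fix z assume "z \<in> complex_of_real ` {0..M}"
        then obtain t where t: "t \<in> {0..M}" "z = complex_of_real t" by auto
        show "dist (poly (q n) z) (cpowr s z) < e"
          using q(2)[OF t(1), of n] n unfolding t(2) dist_norm Re_complex_of_real by linarith
      qed
    qed
  qed
  with q(1) show ?thesis using that by blast
qed

context
  fixes A :: "'a::complex_hilbert \<Rightarrow> 'a"
  assumes pos: "pos_op A"
begin

lemma op_powr_limit:
  assumes M: "M \<ge> 0" "\<And>x. norm (A x) \<le> M * norm x" and s: "s > 0"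
  shows "bounded_clinear (op_powr A s)"
    and "uniform_limit (complex_of_real ` {0..M}) (\<lambda>n. poly (q n)) (cpowr s) sequentially
      \<Longrightarrow> op_limit q A (op_powr A s)"
proof -
  note A = pos_opD[OF pos]
  have sub: "spectrum_op A \<subseteq> complex_of_real ` {0..M}" by (rule spectrum_subset) (use A M in auto)
  obtain q0 where q0: "uniform_limit (complex_of_real ` {0..M}) (\<lambda>n. poly (q0 n)) (cpowr s) sequentially"
    using powr_uniform_limit_poly[OF s M(1)] by blast
  note L = fun_calc_limit[OF A(1,2) uniform_limit_on_subset[OF q0 sub]]
  show "bounded_clinear (op_powr A s)" unfolding op_powr_def by (rule L)
  show "op_limit q A (op_powr A s)"
    if "uniform_limit (complex_of_real ` {0..M}) (\<lambda>n. poly (q n)) (cpowr s) sequentially"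
    unfolding op_powr_def by (rule L(2)[OF uniform_limit_on_subset[OF that sub]])
qed

lemma op_powr_bounded_clinear: "s > 0 \<Longrightarrow> bounded_clinear (op_powr A s)"
  using op_powr_limit(1) bounded_clinear_bound[OF pos_opD(1)[OF pos]] by (metis less_imp_le)

lemma op_powr_approx:
  assumes s: "s > 0"
  obtains q M where "M \<ge> L" "M \<ge> 0" "\<And>x. norm (A x) \<le> M * norm x"
    "uniform_limit (complex_of_real ` {0..M}) (\<lambda>n. poly (q n)) (cpowr s) sequentially"
    "\<And>n. poly (q n) 0 = 0" "op_limit q A (op_powr A s)"
proof -
  obtain K where K: "K > 0" "\<And>x. norm (A x) \<le> K * norm x"
    using bounded_clinear_bound[OF pos_opD(1)[OF pos]] by blast
  define M where "M = max K L"
  have M: "M \<ge> 0" "M \<ge> L" "\<And>x. norm (A x) \<le> M * norm x"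
    using K mult_right_mono[of K M "norm _"] unfolding M_def by (auto intro: order_trans)
  obtain q where q: "uniform_limit (complex_of_real ` {0..M}) (\<lambda>n. poly (q n)) (cpowr s) sequentially"
    "\<And>n. poly (q n) 0 = 0"
    using powr_uniform_limit_poly[OF s M(1)] by blast
  show ?thesis by (rule that[OF M(2,1,3) q op_powr_limit(2)[OF M(1,3) s q(1)]])
qed

lemma op_powr_one: "op_powr A 1 = A"
proof
  fix x
  obtain K where K: "K > 0" "\<And>x. norm (A x) \<le> K * norm x"
    using bounded_clinear_bound[OF pos_opD(1)[OF pos]] by blast
  have "uniform_limit (complex_of_real ` {0..K}) (\<lambda>n. poly [:0, 1:]) (cpowr 1) sequentially"
    by (rule uniform_limitI) auto
  then have "op_limit (\<lambda>n. [:0, 1:]) A (op_powr A 1)"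
    using K by (intro op_powr_limit) auto
  then have "(\<lambda>n. poly_op [:0, 1:] A x) \<longlonglongrightarrow> op_powr A 1 x" by (rule op_limit_tendsto)
  then have "poly_op [:0, 1:] A x = op_powr A 1 x" by (simp add: LIMSEQ_const_iff)
  then show "op_powr A 1 x = A x"
    using pos_opD(1)[OF pos] by (simp add: poly_op_pCons scaleC_one bounded_clinearD)
qed

text \<open>
  The products of the approximating polynomials converge uniformly to the product of the two power functions.
\<close>

lemma op_powr_add:
  assumes s: "s > 0" and t: "t > 0"
  shows "op_powr A s (op_powr A t x) = op_powr A (s + t) x"
proof -
  note A = pos_opD(1)[OF pos]
  obtain M q where q: "M \<ge> 0" "\<And>x. norm (A x) \<le> M * norm x"
    "uniform_limit (complex_of_real ` {0..M}) (\<lambda>n. poly (q n)) (cpowr s) sequentially"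
    "op_limit q A (op_powr A s)"
    using op_powr_approx[OF s, of 0] by metis
  obtain p where p: "uniform_limit (complex_of_real ` {0..M}) (\<lambda>n. poly (p n)) (cpowr t) sequentially"
    using powr_uniform_limit_poly[OF t q(1)] by blast
  have bdd: "bounded (cpowr r ` complex_of_real ` {0..M})" if "r > 0" for r
    using that by (auto simp: bounded_iff intro!: exI[of _ "M powr r"] powr_mono2)
  have "uniform_limit (complex_of_real ` {0..M}) (\<lambda>n z. poly (q n) z * poly (p n) z)
      (\<lambda>z. cpowr s z * cpowr t z) sequentially"
    by (rule uniform_lim_mult[OF q(3) p bdd[OF s] bdd[OF t]])
  then have "uniform_limit (complex_of_real ` {0..M}) (\<lambda>n. poly (q n * p n)) (cpowr (s + t)) sequentially"
    by (simp add: powr_add poly_mult[abs_def])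
  then have "op_limit (\<lambda>n. q n * p n) A (op_powr A (s + t))"
    using q s t by (intro op_powr_limit(2)) auto
  then have "(\<lambda>n. poly_op (q n * p n) A x) \<longlonglongrightarrow> op_powr A (s + t) x" by (rule op_limit_tendsto)
  then have lim: "(\<lambda>n. poly_op (q n) A (poly_op (p n) A x)) \<longlonglongrightarrow> op_powr A (s + t) x"
    by (simp add: poly_op_mult[OF A])
  define u where "u = op_powr A t x"
  have pl: "(\<lambda>n. poly_op (p n) A x) \<longlonglongrightarrow> u"
    unfolding u_def by (rule op_limit_tendsto) (rule op_powr_limit(2)[OF q(1,2) t p])
  have S: "bounded_clinear (op_powr A s)" by (rule op_powr_bounded_clinear[OF s])
  have "(\<lambda>n. poly_op (q n) A (poly_op (p n) A x) - op_powr A s (poly_op (p n) A x)) \<longlonglongrightarrow> 0"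
  proof (rule Lim_null_comparison)
    show "\<forall>\<^sub>F n in sequentially. norm (poly_op (q n) A (poly_op (p n) A x) - op_powr A s (poly_op (p n) A x))
        \<le> onorm (\<lambda>x. poly_op (q n) A x - op_powr A s x) * norm (poly_op (p n) A x)"
      by (rule always_eventually, rule allI, rule onorm)
         (rule bounded_clinearD(7)[OF bounded_clinear_diff[OF bounded_clinear_poly_op[OF A] S]])
    have "(\<lambda>n. onorm (\<lambda>x. poly_op (q n) A x - op_powr A s x)) \<longlonglongrightarrow> 0"
      using q(4) op_limit_iff_onorm[OF A S] by blast
    from tendsto_mult[OF this tendsto_norm[OF pl]]
    show "(\<lambda>n. onorm (\<lambda>x. poly_op (q n) A x - op_powr A s x) * norm (poly_op (p n) A x)) \<longlonglongrightarrow> 0"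
      by simp
  qed
  moreover have "(\<lambda>n. op_powr A s (poly_op (p n) A x)) \<longlonglongrightarrow> op_powr A s u"
    by (rule bounded_linear.tendsto[OF bounded_clinearD(7)[OF S] pl])
  ultimately have "(\<lambda>n. poly_op (q n) A (poly_op (p n) A x)) \<longlonglongrightarrow> op_powr A s u"
    using tendsto_add by fastforce
  then show ?thesis using lim LIMSEQ_unique unfolding u_def by blast
qed

text \<open>
  The adjoint of \<open>q(A)\<close> is the polynomial with conjugate coefficients, and since the limit function is real
  these conjugates approximate it as well.
\<close>

lemma op_powr_is_adjoint:
  assumes s: "s > 0"
  shows "is_adjoint (op_powr A s) (op_powr A s)"
  unfolding is_adjoint_def
proof (intro allI)
  fix x y
  note A = pos_opD(1,2)[OF pos]
  obtain M q where q: "M \<ge> 0" "\<And>x. norm (A x) \<le> M * norm x"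
    "uniform_limit (complex_of_real ` {0..M}) (\<lambda>n. poly (q n)) (cpowr s) sequentially"
    "op_limit q A (op_powr A s)"
    using op_powr_approx[OF s, of 0] by metis
  have "uniform_limit (complex_of_real ` {0..M}) (\<lambda>n. poly (map_poly cnj (q n))) (cpowr s) sequentially"
  proof (rule uniform_limitI)
    fix e :: real assume "e > 0"
    then have "\<forall>\<^sub>F n in sequentially. \<forall>z\<in>complex_of_real ` {0..M}. dist (poly (q n) z) (cpowr s z) < e"
      by (rule uniform_limitD[OF q(3)])
    moreover have "dist (cnj w) (complex_of_real r) = dist w (complex_of_real r)" for w r
      by (metis complex_cnj_complex_of_real complex_cnj_diff complex_mod_cnj dist_norm)
    ultimately show "\<forall>\<^sub>F n in sequentially. \<forall>z\<in>complex_of_real ` {0..M}.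
        dist (poly (map_poly cnj (q n)) z) (cpowr s z) < e"
      by simp
  qed
  then have "op_limit (\<lambda>n. map_poly cnj (q n)) A (op_powr A s)"
    by (rule op_powr_limit(2)[OF q(1,2) s])
  then have "(\<lambda>n. inner x (poly_op (map_poly cnj (q n)) A y)) \<longlonglongrightarrow> inner x (op_powr A s y)"
    by (intro tendsto_intros op_limit_tendsto[of "\<lambda>n. map_poly cnj (q n)"])
  moreover have "(\<lambda>n. inner (poly_op (q n) A x) y) \<longlonglongrightarrow> inner (op_powr A s x) y"
    by (intro tendsto_intros op_limit_tendsto q(4))
  ultimately show "inner (op_powr A s x) y = inner x (op_powr A s y)"
    using is_adjoint_poly_op[OF A] LIMSEQ_unique by (simp add: is_adjoint_def)
qed

lemma inner_op_powr_eq: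
  assumes "s > 0"
  shows "inner (op_powr A s x) x = (norm (op_powr A (s / 2) x))\<^sup>2"
proof -
  have "op_powr A (s / 2) (op_powr A (s / 2) x) = op_powr A s x"
    using op_powr_add[of "s / 2" "s / 2"] assms by simp
  moreover have "is_adjoint (op_powr A (s / 2)) (op_powr A (s / 2))"
    using assms by (intro op_powr_is_adjoint) simp
  ultimately show ?thesis
    unfolding power2_norm_eq_inner is_adjoint_def by (metis inner_commute)
qed

lemma pos_op_powr: "s > 0 \<Longrightarrow> pos_op (op_powr A s)"
  by (simp add: pos_op_def op_powr_bounded_clinear op_powr_is_adjoint inner_op_powr_eq)

lemma op_powr_eigenvector:
  assumes s: "s > 0" and "l \<ge> 0" and x: "A x = l *\<^sub>R x"
  shows "op_powr A s x = (l powr s) *\<^sub>R x"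
proof -
  obtain M q where q: "M \<ge> l"
    "uniform_limit (complex_of_real ` {0..M}) (\<lambda>n. poly (q n)) (cpowr s) sequentially"
    "op_limit q A (op_powr A s)"
    using op_powr_approx[OF s, of l] by metis
  have ql: "(\<lambda>n. poly (q n) (complex_of_real l)) \<longlonglongrightarrow> cpowr s (complex_of_real l)"
    by (rule tendsto_uniform_limitI[OF q(2)]) (use assms q(1) in auto)
  have "(\<lambda>n. poly (q n) (complex_of_real l) *\<^sub>C x) \<longlonglongrightarrow> cpowr s (complex_of_real l) *\<^sub>C x"
  proof (rule LIM_zero_cancel, rule tendsto_norm_zero_cancel)
    have "(\<lambda>n. cmod (poly (q n) (complex_of_real l) - cpowr s (complex_of_real l)) * norm x) \<longlonglongrightarrow> 0 * norm x"
      using ql by (intro tendsto_mult tendsto_const) (simp add: LIM_zero tendsto_norm_zero)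
    then show "(\<lambda>n. norm (poly (q n) (complex_of_real l) *\<^sub>C x - cpowr s (complex_of_real l) *\<^sub>C x)) \<longlonglongrightarrow> 0"
      by (simp flip: scaleC_diff_left)
  qed
  moreover have "poly_op (q n) A x = poly (q n) (complex_of_real l) *\<^sub>C x" for n
    using x by (intro poly_op_eigenvector pos_opD(1)[OF pos]) (simp add: scaleR_scaleC)
  ultimately have "(\<lambda>n. poly_op (q n) A x) \<longlonglongrightarrow> (l powr s) *\<^sub>R x" by (simp add: scaleR_scaleC)
  then show ?thesis using op_limit_tendsto[OF q(3)] LIMSEQ_unique by blast
qed

lemma op_powr_invariant:
  assumes s: "s > 0" and W: "csubspace W" "closed W" "A ` W \<subseteq> W" and x: "x \<in> W"
  shows "op_powr A s x \<in> W"
proof -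
  obtain q where "op_limit q A (op_powr A s)" using op_powr_approx[OF s, of 0] by metis
  then have "(\<lambda>n. poly_op (q n) A x) \<longlonglongrightarrow> op_powr A s x" by (rule op_limit_tendsto)
  then show ?thesis
    by (rule closed_sequentially[OF W(2), rotated])
       (use poly_op_invariant[OF pos_opD(1)[OF pos] W(1,3) x] in simp)
qed

text \<open>
  On \<open>W\<close> the approximate point spectrum of \<open>A\<close> lies in \<open>[0, m]\<close>, which may be much smaller than the spectrum of
  \<open>A\<close> on the whole space.
\<close>

lemma norm_op_powr_le_on:
  assumes s: "s > 0" and W: "csubspace W" "A ` W \<subseteq> W" and x: "x \<in> W"
    and m: "m \<ge> 0" "\<And>y. y \<in> W \<Longrightarrow> norm (A y) \<le> m * norm y"
  shows "norm (op_powr A s x) \<le> m powr s * norm x"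
proof -
  note A = pos_opD[OF pos]
  obtain M q where q: "M \<ge> m"
    "uniform_limit (complex_of_real ` {0..M}) (\<lambda>n. poly (q n)) (cpowr s) sequentially"
    "op_limit q A (op_powr A s)"
    using op_powr_approx[OF s, of m] by metis
  have *: "norm (op_powr A s x) \<le> (m powr s + e) * norm x" if e: "e > 0" for e
  proof (rule tendsto_upperbound)
    show "(\<lambda>n. norm (poly_op (q n) A x)) \<longlonglongrightarrow> norm (op_powr A s x)"
      by (intro tendsto_intros op_limit_tendsto q)
    have "\<forall>\<^sub>F n in sequentially. \<forall>z\<in>complex_of_real ` {0..M}. dist (poly (q n) z) (cpowr s z) < e"
      by (rule uniform_limitD[OF q(2) e])
    then show "\<forall>\<^sub>F n in sequentially. norm (poly_op (q n) A x) \<le> (m powr s + e) * norm x"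
    proof (rule eventually_mono)
      fix n assume n: "\<forall>z\<in>complex_of_real ` {0..M}. dist (poly (q n) z) (cpowr s z) < e"
      show "norm (poly_op (q n) A x) \<le> (m powr s + e) * norm x"
      proof (rule norm_poly_op_le[OF A(1,2) W])
        fix z assume z: "\<not> bounded_below_on W (\<lambda>x. A x - z *\<^sub>C x)"
        have "z \<in> complex_of_real ` {0..m}"
          using bounded_below_on_shift[OF A(1,2) A(3) m(2)] z by blast
        then obtain t where t: "0 \<le> t" "t \<le> m" "z = complex_of_real t" by auto
        then have "dist (poly (q n) z) (cpowr s z) < e" using n q(1) by auto
        then have "cmod (poly (q n) z) \<le> cmod (cpowr s z) + e"
          using norm_triangle_sub[of "poly (q n) z" "cpowr s z"] by (simp add: dist_norm)
        also have "cmod (cpowr s z) \<le> m powr s" using t s by (simp add: powr_mono2)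
        finally show "cmod (poly (q n) z) \<le> m powr s + e" by simp
      qed (use e x in auto)
    qed
  qed simp
  have "norm (op_powr A s x) \<le> m powr s * norm x + d" if d: "d > 0" for d
  proof -
    define e where "e = d / (norm x + 1)"
    have e: "e > 0" using d by (simp add: e_def add_nonneg_pos)
    have "e * norm x \<le> e * (norm x + 1)" using e by simp
    also have "\<dots> = d" by (simp add: e_def add_nonneg_eq_0_iff)
    finally show ?thesis using *[OF e] by (simp add: distrib_right)
  qed
  then show ?thesis by (rule field_le_epsilon)
qed

end

section \<open>Compactness\<close>

text \<open>
  A form of compactness in which \<open>e\<close> is fixed before the subsequence is chosen. For bounded
  linear operators on a Hilbert space it is equivalent to the usual one, and it passes to norm limits without a diagonal argument.
\<close>

definition eps_compact :: "('a::real_normed_vector \<Rightarrow> 'a) \<Rightarrow> bool" where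
  "eps_compact K \<longleftrightarrow> (\<forall>x :: nat \<Rightarrow> 'a. bounded (range x) \<longrightarrow> (\<forall>e>0. \<exists>r :: nat \<Rightarrow> nat.
      strict_mono r \<and> (\<forall>m n. norm (K (x (r m)) - K (x (r n))) < e)))"

lemma eps_compactD:
  assumes "eps_compact K" "bounded (range x)" "e > 0"
  obtains r :: "nat \<Rightarrow> nat" where "strict_mono r" "\<And>m n. norm (K (x (r m)) - K (x (r n))) < e"
  using assms unfolding eps_compact_def by blast

lemma compact_op_imp_eps_compact:
  assumes "compact_op K"
  shows "eps_compact K"
  unfolding eps_compact_def
proof (intro allI impI)
  fix x :: "nat \<Rightarrow> 'a" and e :: real
  assume x: "bounded (range x)" and e: "e > 0"
  have "seq_compact (closure (K ` range x))"
    using assms x compact_imp_seq_compact unfolding compact_op_def by blast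
  moreover have "\<forall>n. K (x n) \<in> closure (K ` range x)"
    by (auto intro!: closure_subset[THEN subsetD])
  ultimately obtain l r where r: "strict_mono (r :: nat \<Rightarrow> nat)" "((\<lambda>n. K (x n)) \<circ> r) \<longlonglongrightarrow> l"
    by (rule seq_compactE)
  then have "\<forall>\<^sub>F n in sequentially. dist (K (x (r n))) l < e / 2"
    using tendstoD[OF r(2), of "e / 2"] e by simp
  then obtain N where N: "\<And>n. n \<ge> N \<Longrightarrow> dist (K (x (r n))) l < e / 2"
    by (auto simp: eventually_sequentially)
  have "strict_mono (\<lambda>n. r (n + N))" using r(1) by (simp add: strict_mono_def)
  moreover have "norm (K (x (r (m + N))) - K (x (r (n + N)))) < e" for m n
    using dist_triangle_half_l[OF N[of "m + N"] N[of "n + N"]] by (simp add: dist_norm)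
  ultimately show "\<exists>r :: nat \<Rightarrow> nat. strict_mono r \<and> (\<forall>m n. norm (K (x (r m)) - K (x (r n))) < e)"
    by blast
qed

lemma eps_compact_comp_left:
  assumes K: "eps_compact K" and Y: "bounded_linear Y"
  shows "eps_compact (\<lambda>x. Y (K x))"
  unfolding eps_compact_def
proof (intro allI impI)
  fix x :: "nat \<Rightarrow> 'a" and e :: real
  assume x: "bounded (range x)" and e: "e > 0"
  obtain L where L: "L > 0" "\<And>u. norm (Y u) \<le> norm u * L" using bounded_linear.pos_bounded[OF Y] by blast
  obtain r :: "nat \<Rightarrow> nat" where r: "strict_mono r" "\<And>m n. norm (K (x (r m)) - K (x (r n))) < e / L"
    using eps_compactD[OF K x, of "e / L"] e L(1) by auto
  have "norm (Y (K (x (r m))) - Y (K (x (r n)))) < e" for m n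
  proof -
    have "norm (Y (K (x (r m))) - Y (K (x (r n)))) \<le> norm (K (x (r m)) - K (x (r n))) * L"
      using L(2) by (simp flip: linear_diff[OF bounded_linear.linear[OF Y]])
    also have "\<dots> < e" using r(2)[of m n] L(1) by (simp add: pos_less_divide_eq)
    finally show ?thesis .
  qed
  with r(1) show "\<exists>r :: nat \<Rightarrow> nat. strict_mono r \<and> (\<forall>m n. norm (Y (K (x (r m))) - Y (K (x (r n)))) < e)"
    by blast
qed

lemma eps_compact_comp_right:
  assumes K: "eps_compact K" and Y: "bounded_linear Y"
  shows "eps_compact (\<lambda>x. K (Y x))"
  unfolding eps_compact_def
proof (intro allI impI)
  fix x :: "nat \<Rightarrow> 'a" and e :: real
  assume x: "bounded (range x)" and e: "e > 0"
  have "bounded (range (\<lambda>n. Y (x n)))"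
    using bounded_linear_image[OF x Y] by (simp add: image_image)
  then obtain r :: "nat \<Rightarrow> nat" where "strict_mono r" "\<And>m n. norm (K (Y (x (r m))) - K (Y (x (r n)))) < e"
    using eps_compactD[OF K _ e] by metis
  then show "\<exists>r :: nat \<Rightarrow> nat. strict_mono r \<and> (\<forall>m n. norm (K (Y (x (r m))) - K (Y (x (r n)))) < e)"
    by blast
qed

lemma eps_compact_limit:
  assumes "\<And>e. e > 0 \<Longrightarrow> \<exists>K. eps_compact K \<and> (\<forall>x. norm (K x - S x) \<le> e * norm x)"
  shows "eps_compact S"
  unfolding eps_compact_def
proof (intro allI impI)
  fix x :: "nat \<Rightarrow> 'a" and e :: real
  assume x: "bounded (range x)" and e: "e > 0"
  obtain c where c: "c > 0" "\<And>n. norm (x n) \<le> c" using x unfolding bounded_pos by auto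
  obtain K where K: "eps_compact K" "\<And>u. norm (K u - S u) \<le> (e / (4 * c)) * norm u"
    using assms[of "e / (4 * c)"] e c(1) by auto
  obtain r :: "nat \<Rightarrow> nat" where r: "strict_mono r" "\<And>m n. norm (K (x (r m)) - K (x (r n))) < e / 2"
    using eps_compactD[OF K(1) x, of "e / 2"] e by auto
  have KS: "norm (K (x n) - S (x n)) \<le> e / 4" for n
  proof -
    have "norm (K (x n) - S (x n)) \<le> (e / (4 * c)) * norm (x n)" by (rule K)
    also have "\<dots> \<le> (e / (4 * c)) * c" using c e by (intro mult_left_mono) auto
    also have "\<dots> = e / 4" using c by simp
    finally show ?thesis .
  qed
  have "norm (S (x (r m)) - S (x (r n))) < e" for m n
  proof -
    have "S (x (r m)) - S (x (r n)) =
        (K (x (r m)) - K (x (r n))) - (K (x (r m)) - S (x (r m))) + (K (x (r n)) - S (x (r n)))" by simp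
    then have "norm (S (x (r m)) - S (x (r n))) \<le> norm (K (x (r m)) - K (x (r n)))
        + norm (K (x (r m)) - S (x (r m))) + norm (K (x (r n)) - S (x (r n)))"
      by (metis norm_triangle_le_diff norm_triangle_le add_mono order_refl)
    then show ?thesis using r(2)[of m n] KS[of "r m"] KS[of "r n"] by linarith
  qed
  with r(1) show "\<exists>r :: nat \<Rightarrow> nat. strict_mono r \<and> (\<forall>m n. norm (S (x (r m)) - S (x (r n))) < e)"
    by blast
qed

text \<open>
  Applied to the differences \<open>x\<^sub>m - x\<^sub>n\<close> of a bounded sequence, the inequality makes \<open>S x\<^sub>m - S x\<^sub>n\<close> small as soon
  as \<open>K x\<^sub>m - K x\<^sub>n\<close> is small.
\<close>

lemma eps_compact_dominated:
  assumes K: "eps_compact K" "bounded_linear K" and S: "bounded_linear S"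
    and dom: "\<And>x. norm (S x) powr a \<le> norm (K x) powr b * norm x powr c"
    and abc: "a > 0" "b > 0" "c \<ge> 0"
  shows "eps_compact S"
  unfolding eps_compact_def
proof (intro allI impI)
  fix x :: "nat \<Rightarrow> 'a" and e :: real
  assume x: "bounded (range x)" and e: "e > 0"
  obtain l where l: "l > 0" "\<And>n. norm (x n) \<le> l" using x unfolding bounded_pos by auto
  \<comment> \<open>The solution of \<open>d\<^sup>b (2 l)\<^sup>c = e\<^sup>a\<close>, where \<open>2 l\<close> bounds the differences of the sequence.\<close>
  define d where "d = (e powr a / (2 * l) powr c) powr (1 / b)"
  have d: "d > 0" "d powr b = e powr a / (2 * l) powr c"
    using e l abc by (simp_all add: d_def powr_powr)
  have small: "norm (S u) < e" if u: "norm u \<le> 2 * l" "norm (K u) < d" for u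
  proof (rule ccontr)
    assume "\<not> norm (S u) < e"
    then have "e powr a \<le> norm (S u) powr a" using e abc by (intro powr_mono2) auto
    also have "\<dots> \<le> norm (K u) powr b * norm u powr c" by (rule dom)
    also have "\<dots> \<le> norm (K u) powr b * (2 * l) powr c"
      using u abc by (intro mult_left_mono powr_mono2) auto
    also have "\<dots> < d powr b * (2 * l) powr c"
      using u abc l by (intro mult_strict_right_mono powr_less_mono2) auto
    also have "\<dots> = e powr a" using d l by simp
    finally show False by simp
  qed
  obtain r :: "nat \<Rightarrow> nat" where r: "strict_mono r" "\<And>m n. norm (K (x (r m)) - K (x (r n))) < d"
    using eps_compactD[OF K(1) x d(1)] by blast
  have "norm (S (x (r m)) - S (x (r n))) < e" for m n
    using small[of "x (r m) - x (r n)"] r(2)[of m n]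
      norm_triangle_le_diff[of "x (r m)" "x (r n)" "2 * l"] l(2)[of "r m"] l(2)[of "r n"]
    by (simp add: linear_diff[OF bounded_linear.linear[OF K(2)]] linear_diff[OF bounded_linear.linear[OF S]])
  with r(1) show "\<exists>r :: nat \<Rightarrow> nat. strict_mono r \<and> (\<forall>m n. norm (S (x (r m)) - S (x (r n))) < e)"
    by blast
qed

text \<open>
  The diagonal argument: the tails of the diagonal subsequence meet every bound \<open>1 / (n + 1)\<close>.
\<close>

lemma eps_compact_Cauchy_subsequence:
  fixes x :: "nat \<Rightarrow> 'a::real_normed_vector"
  assumes K: "eps_compact K" and x: "bounded (range x)"
  obtains r :: "nat \<Rightarrow> nat" where "strict_mono r" "Cauchy (\<lambda>n. K (x (r n)))"
proof -
  let ?P = "\<lambda>n (s :: nat \<Rightarrow> nat). \<forall>i j. norm (K (x (s i)) - K (x (s j))) < inverse (real (Suc n))"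
  interpret subseqs ?P
  proof
    fix n :: nat and s :: "nat \<Rightarrow> nat" assume "strict_mono s"
    have "bounded (range (\<lambda>i. x (s i)))" by (rule bounded_subset[OF x]) auto
    then obtain r' :: "nat \<Rightarrow> nat" where "strict_mono r'"
      "\<And>i j. norm (K (x (s (r' i))) - K (x (s (r' j)))) < inverse (real (Suc n))"
      using eps_compactD[OF K, of "\<lambda>i. x (s i)" "inverse (real (Suc n))"] by auto
    then show "\<exists>r'::nat \<Rightarrow> nat. strict_mono r' \<and> ?P n (s \<circ> r')" unfolding o_def by blast
  qed
  have tail: "?P k (diagseq \<circ> ((+) (Suc k)))" for k by (rule diagseq_holds) auto
  have "Cauchy (\<lambda>n. K (x (diagseq n)))"
  proof (rule metric_CauchyI)
    fix e :: real assume "e > 0"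
    then obtain k where k: "inverse (real (Suc k)) < e" using reals_Archimedean by blast
    have "dist (K (x (diagseq m))) (K (x (diagseq n))) < e" if "m \<ge> Suc k" "n \<ge> Suc k" for m n
      using tail[of k, rule_format, of "m - Suc k" "n - Suc k"] that k by (simp add: dist_norm)
    then show "\<exists>N. \<forall>m\<ge>N. \<forall>n\<ge>N. dist (K (x (diagseq m))) (K (x (diagseq n))) < e" by blast
  qed
  with subseq_diagseq show ?thesis by (rule that)
qed

text \<open>
  The approximating polynomials vanish at \<open>0\<close>, so a factor \<open>C\<close> can be split off.
\<close>

lemma op_powr_poly_multiple_approx:
  fixes C :: "'a::complex_hilbert \<Rightarrow> 'a"
  assumes C: "pos_op C" and s: "s > 0" and "e > 0"
  obtains q where "\<And>x. norm (C (poly_op q C x) - op_powr C s x) \<le> e * norm x"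
proof -
  obtain q where q: "\<And>n. poly (q n) 0 = 0" "op_limit q C (op_powr C s)"
    using op_powr_approx[OF C s, of 0] by metis
  obtain n where n: "\<And>x. norm (poly_op (q n) C x - op_powr C s x) \<le> e * norm x"
    using q(2) assms unfolding op_limit_def eventually_sequentially by blast
  obtain q' where "q n = pCons 0 q'" using q(1)[of n] by (cases "q n") simp
  then have "norm (C (poly_op q' C x) - op_powr C s x) \<le> e * norm x" for x
    using n[of x] by (simp add: poly_op_pCons[OF pos_opD(1)[OF C]])
  then show ?thesis by (rule that)
qed

context
  fixes C X :: "'a::complex_hilbert \<Rightarrow> 'a" and s :: real
  assumes C: "pos_op C" and X: "bounded_clinear X" and s: "s > 0"
begin

lemma eps_compact_op_powr_left:
  assumes K: "eps_compact (\<lambda>x. C (X x))"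
  shows "eps_compact (\<lambda>x. op_powr C s (X x))"
proof (rule eps_compact_limit)
  fix e :: real assume e: "e > 0"
  obtain L where L: "L > 0" "\<And>x. norm (X x) \<le> L * norm x" using bounded_clinear_bound[OF X] by blast
  obtain q where q: "\<And>x. norm (C (poly_op q C x) - op_powr C s x) \<le> (e / L) * norm x"
    using op_powr_poly_multiple_approx[OF C s, of "e / L"] e L(1) by auto
  have "eps_compact (\<lambda>x. poly_op q C (C (X x)))"
    by (rule eps_compact_comp_left[OF K])
       (rule bounded_clinearD(7)[OF bounded_clinear_poly_op[OF pos_opD(1)[OF C]]])
  moreover have "norm (poly_op q C (C (X x)) - op_powr C s (X x)) \<le> e * norm x" for x
  proof -
    have "norm (poly_op q C (C (X x)) - op_powr C s (X x)) \<le> (e / L) * norm (X x)"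
      using q[of "X x"] by (simp add: poly_op_commute[OF pos_opD(1)[OF C]])
    also have "\<dots> \<le> (e / L) * (L * norm x)" using e L by (intro mult_left_mono) auto
    also have "\<dots> = e * norm x" using L by simp
    finally show ?thesis .
  qed
  ultimately show "\<exists>K. eps_compact K \<and> (\<forall>x. norm (K x - op_powr C s (X x)) \<le> e * norm x)"
    by (intro exI[of _ "\<lambda>x. poly_op q C (C (X x))"]) simp
qed

lemma eps_compact_op_powr_right:
  assumes K: "eps_compact (\<lambda>x. X (C x))"
  shows "eps_compact (\<lambda>x. X (op_powr C s x))"
proof (rule eps_compact_limit)
  fix e :: real assume e: "e > 0"
  obtain L where L: "L > 0" "\<And>x. norm (X x) \<le> L * norm x" using bounded_clinear_bound[OF X] by blast
  obtain q where q: "\<And>x. norm (C (poly_op q C x) - op_powr C s x) \<le> (e / L) * norm x"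
    using op_powr_poly_multiple_approx[OF C s, of "e / L"] e L(1) by auto
  have "eps_compact (\<lambda>x. X (C (poly_op q C x)))"
    by (rule eps_compact_comp_right[OF K])
       (rule bounded_clinearD(7)[OF bounded_clinear_poly_op[OF pos_opD(1)[OF C]]])
  moreover have "norm (X (C (poly_op q C x)) - X (op_powr C s x)) \<le> e * norm x" for x
  proof -
    have "norm (X (C (poly_op q C x)) - X (op_powr C s x)) \<le> L * norm (C (poly_op q C x) - op_powr C s x)"
      using L(2) by (simp flip: bounded_clinearD(2)[OF X])
    also have "\<dots> \<le> L * ((e / L) * norm x)" using q L by (intro mult_left_mono) auto
    also have "\<dots> = e * norm x" using L by simp
    finally show ?thesis .
  qed
  ultimately show "\<exists>K. eps_compact K \<and> (\<forall>x. norm (K x - X (op_powr C s x)) \<le> e * norm x)"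
    by (intro exI[of _ "\<lambda>x. X (C (poly_op q C x))"]) simp
qed

end

text \<open>
  From \<open>\<parallel>C\<^sup>t\<^sup>/\<^sup>2 x\<parallel>\<^sup>2 \<le> \<parallel>C\<^sup>t x\<parallel> \<parallel>x\<parallel>\<close> the exponent can be halved until it is below \<open>1\<close>; then \<open>C\<close> is the product of \<open>C\<^sup>t\<close> and a
  bounded operator.
\<close>

lemma eps_compact_of_op_powr:
  fixes C :: "'a::complex_hilbert \<Rightarrow> 'a"
  assumes C: "pos_op C" and s: "s > 0" and K: "eps_compact (op_powr C s)"
  shows "eps_compact C"
proof -
  have half: "eps_compact (op_powr C (s / 2 ^ k))" for k
  proof (induction k)
    case (Suc k)
    define t where "t = s / 2 ^ k"
    have t: "t > 0" using s by (simp add: t_def)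
    have "norm (op_powr C (t / 2) x) powr 2 \<le> norm (op_powr C t x) powr 1 * norm x powr 1" for x
      using norm_cauchy_schwarz[of "op_powr C t x" x] inner_op_powr_eq[OF C t] by simp
    moreover have "bounded_linear (op_powr C u)" if "u > 0" for u
      using bounded_clinearD(7)[OF op_powr_bounded_clinear[OF C that]] .
    ultimately have "eps_compact (op_powr C (t / 2))"
      using Suc.IH[folded t_def] t eps_compact_dominated[of "op_powr C t" "op_powr C (t / 2)" 2 1 1] by auto
    then show ?case by (simp add: t_def mult.commute)
  qed (simp add: K)
  obtain k where k: "s < 2 ^ k" using real_arch_pow[of 2 s] by auto
  define t where "t = s / 2 ^ k"
  have t: "0 < t" "t < 1" using s k by (simp_all add: t_def)
  have "op_powr C (1 - t) (op_powr C t x) = C x" for x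
    using op_powr_add[OF C, of "1 - t" t x] t op_powr_one[OF C] by simp
  moreover have "eps_compact (\<lambda>x. op_powr C (1 - t) (op_powr C t x))"
    using eps_compact_comp_left[OF half[of k, folded t_def]]
      bounded_clinearD(7)[OF op_powr_bounded_clinear[OF C, of "1 - t"]] t by simp
  ultimately show ?thesis by simp
qed

section \<open>Norm-attaining vectors\<close>

text \<open>Since \<open>T\<^sup>* z\<close> lies in \<open>W\<close>, the bound for \<open>T\<close> applies to it in \<open>\<parallel>T\<^sup>* z\<parallel>\<^sup>2 = \<langle>T T\<^sup>* z, z\<rangle>\<close>.\<close>

lemma norm_adjoint_le_on:
  assumes "is_adjoint T T'" "\<And>y. y \<in> W \<Longrightarrow> norm (T y) \<le> m * norm y" "T' ` W \<subseteq> W" "z \<in> W"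
  shows "norm (T' z) \<le> m * norm z"
proof (cases "T' z = 0")
  case False
  have "norm (T' z) * norm (T' z) = inner (T (T' z)) z"
    using assms(1) by (simp add: is_adjoint_def norm_eq_sqrt_inner)
  also have "\<dots> \<le> norm (T (T' z)) * norm z" by (rule norm_cauchy_schwarz)
  also have "\<dots> \<le> (m * norm (T' z)) * norm z" using assms by (intro mult_right_mono) auto
  finally have "norm (T' z) * norm (T' z) \<le> (m * norm z) * norm (T' z)" by (simp add: mult_ac)
  then show ?thesis by (rule mult_right_le_imp_le) (use False in simp)
next
  case True
  have "norm (T z) \<le> m * norm z" using assms by simp
  then show ?thesis using True norm_ge_zero[of "T z"] by (simp del: norm_ge_zero)
qed

text \<open>
  Expand the square and use \<open>\<langle>T\<^sup>* T y, y\<rangle> = \<parallel>T y\<parallel>\<^sup>2\<close>. A vector at which \<open>T\<close> almost attains the norm \<open>m\<close> is thus almost an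
  eigenvector of \<open>T\<^sup>* T\<close>.
\<close>

lemma norm_defect_le:
  assumes adj: "is_adjoint T T'" and "norm (T' (T y)) \<le> m * norm (T y)"
  shows "(norm (T' (T y) - m\<^sup>2 *\<^sub>R y))\<^sup>2 \<le> m\<^sup>2 * (m\<^sup>2 * (norm y)\<^sup>2 - (norm (T y))\<^sup>2)"
proof -
  have "(norm (T' (T y)))\<^sup>2 \<le> m\<^sup>2 * (norm (T y))\<^sup>2"
    using power_mono[OF assms(2), of 2] by (simp add: power_mult_distrib)
  moreover have "inner (T' (T y)) y = (norm (T y))\<^sup>2"
    using is_adjoint_sym[OF adj] by (simp add: is_adjoint_def power2_norm_eq_inner)
  then have "(norm (T' (T y) - m\<^sup>2 *\<^sub>R y))\<^sup>2
      = (norm (T' (T y)))\<^sup>2 - 2 * m\<^sup>2 * (norm (T y))\<^sup>2 + (m\<^sup>2)\<^sup>2 * (norm y)\<^sup>2"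
    by (simp only: norm_diff_scaleR_power2)
  ultimately show ?thesis by (simp add: algebra_simps power2_eq_square)
qed

lemma eigenvector_if_norm_attained:
  assumes adj: "is_adjoint T T'" and le: "norm (T' (T y)) \<le> m * norm (T y)"
    and ge: "m * norm y \<le> norm (T y)" and m: "m \<ge> 0"
  shows "T' (T y) = m\<^sup>2 *\<^sub>R y"
proof -
  have "m\<^sup>2 * (norm y)\<^sup>2 \<le> (norm (T y))\<^sup>2"
    using power_mono[OF ge, of 2] m by (simp add: power_mult_distrib)
  then have "m\<^sup>2 * (m\<^sup>2 * (norm y)\<^sup>2 - (norm (T y))\<^sup>2) \<le> 0" by (simp add: mult_nonneg_nonpos)
  then have "(norm (T' (T y) - m\<^sup>2 *\<^sub>R y))\<^sup>2 \<le> 0" using norm_defect_le[OF adj le] by linarith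
  then show ?thesis by simp
qed

lemma pos_op_adjoint_comp:
  assumes "bounded_clinear T" "is_adjoint T T'"
  shows "pos_op (T' \<circ> T)"
proof -
  have "bounded_clinear (\<lambda>x. T' (T x))"
    by (rule bounded_clinear_comp[OF is_adjoint_bounded_clinear[OF assms] assms(1)])
  moreover have *: "inner (T' (T x)) y = inner (T x) (T y)" for x y
    using is_adjoint_sym[OF assms(2)] by (simp add: is_adjoint_def)
  moreover have "inner (T' (T x)) y = inner x (T' (T y))" for x y
    unfolding * using assms(2) by (simp add: is_adjoint_def)
  ultimately show ?thesis
    unfolding pos_op_def is_adjoint_def o_def using inner_ge_zero by metis
qed

lemma norm_sqrt_adjoint_comp:
  fixes T :: "'a::complex_hilbert \<Rightarrow> 'a"
  assumes "bounded_clinear T" "is_adjoint T T'"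
  shows "norm (op_powr (T' \<circ> T) (1/2) x) = norm (T x)"
proof -
  note P = pos_op_adjoint_comp[OF assms]
  have "(norm (op_powr (T' \<circ> T) (1/2) x))\<^sup>2 = inner (T' (T x)) x"
    using inner_op_powr_eq[OF P, of 1 x] op_powr_one[OF P] by simp
  also have "\<dots> = (norm (T x))\<^sup>2"
    using is_adjoint_sym[OF assms(2)] by (simp add: is_adjoint_def power2_norm_eq_inner)
  finally show ?thesis by (simp add: power2_eq_iff_nonneg)
qed

text \<open>
  Unit vectors \<open>x\<^sub>n\<close> of \<open>W\<close> that nearly attain the norm satisfy \<open>T\<^sup>* T x\<^sub>n - m\<^sup>2 x\<^sub>n \<rightarrow> 0\<close>. Compactness makes a subsequence
  of \<open>T\<^sup>* T x\<^sub>n\<close> converge, and since \<open>m\<^sup>2 > 0\<close> the vectors \<open>x\<^sub>n\<close> converge along with it.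
\<close>

lemma exists_top_eigenvector:
  fixes T T' :: "'a::complex_hilbert \<Rightarrow> 'a"
  assumes T: "bounded_clinear T" and T': "bounded_clinear T'" and adj: "is_adjoint T T'"
    and K: "eps_compact (\<lambda>x. T' (T x))"
    and W: "csubspace W" "closed W" "T ` W \<subseteq> W" "T' ` W \<subseteq> W"
    and m: "m > 0" "\<And>y. y \<in> W \<Longrightarrow> norm (T y) \<le> m * norm y"
    and least: "\<And>\<kappa>. \<kappa> \<ge> 0 \<Longrightarrow> (\<And>y. y \<in> W \<Longrightarrow> norm (T y) \<le> \<kappa> * norm y) \<Longrightarrow> m \<le> \<kappa>"
  obtains x where "x \<in> W" "x \<noteq> 0" "T' (T x) = m\<^sup>2 *\<^sub>R x"
proof -
  have "\<exists>x\<in>W. norm x = 1 \<and> norm (T x) \<ge> max 0 (m - inverse (real (Suc n)))" for n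
  proof -
    let ?k = "max 0 (m - inverse (real (Suc n)))"
    have "\<not> m \<le> ?k" using m(1) by (simp add: max_def)
    then obtain y where y: "y \<in> W" "\<not> norm (T y) \<le> ?k * norm y" using least[of ?k] by auto
    then have y0: "y \<noteq> 0" by (auto simp: bounded_clinearD[OF T])
    have "?k * norm y \<le> norm (T y)" using y(2) by linarith
    then have "?k \<le> norm (T y) / norm y" by (rule pos_le_divide_eq[THEN iffD2, rotated]) (use y0 in simp)
    then show ?thesis
      using y y0 csubspace_scaleR[OF W(1) y(1), of "1 / norm y"]
      by (intro bexI[of _ "(1 / norm y) *\<^sub>R y"]) (auto simp: bounded_clinearD[OF T])
  qed
  then obtain x where x: "\<And>n. x n \<in> W" "\<And>n. norm (x n) = 1"
    "\<And>n. norm (T (x n)) \<ge> max 0 (m - inverse (real (Suc n)))"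
    by metis
  have defect: "(\<lambda>n. T' (T (x n)) - m\<^sup>2 *\<^sub>R x n) \<longlonglongrightarrow> 0"
  proof (rule tendsto_norm_zero_cancel, rule real_tendsto_sandwich)
    show "\<forall>\<^sub>F n in sequentially. 0 \<le> norm (T' (T (x n)) - m\<^sup>2 *\<^sub>R x n)" by simp
    have "norm (T' (T (x n)) - m\<^sup>2 *\<^sub>R x n)
        \<le> sqrt (m\<^sup>2 * (m\<^sup>2 - (max 0 (m - inverse (real (Suc n))))\<^sup>2))" for n
    proof (rule real_le_rsqrt)
      have "norm (T' (T (x n))) \<le> m * norm (T (x n))"
        using W x by (intro norm_adjoint_le_on[OF adj m(2) W(4)]) auto
      then have "(norm (T' (T (x n)) - m\<^sup>2 *\<^sub>R x n))\<^sup>2 \<le> m\<^sup>2 * (m\<^sup>2 - (norm (T (x n)))\<^sup>2)"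
        using norm_defect_le[OF adj, of "x n" m] x(2)[of n] by simp
      also have "\<dots> \<le> m\<^sup>2 * (m\<^sup>2 - (max 0 (m - inverse (real (Suc n))))\<^sup>2)"
        using x(3)[of n] by (intro mult_left_mono diff_left_mono power_mono) auto
      finally show "(norm (T' (T (x n)) - m\<^sup>2 *\<^sub>R x n))\<^sup>2 \<le> \<dots>" .
    qed
    then show "\<forall>\<^sub>F n in sequentially. norm (T' (T (x n)) - m\<^sup>2 *\<^sub>R x n)
        \<le> sqrt (m\<^sup>2 * (m\<^sup>2 - (max 0 (m - inverse (real (Suc n))))\<^sup>2))" by simp
    have "(\<lambda>n. sqrt (m\<^sup>2 * (m\<^sup>2 - (max 0 (m - inverse (real (Suc n))))\<^sup>2)))
        \<longlonglongrightarrow> sqrt (m\<^sup>2 * (m\<^sup>2 - (max 0 (m - 0))\<^sup>2))"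
      by (intro tendsto_intros LIMSEQ_inverse_real_of_nat)
    then show "(\<lambda>n. sqrt (m\<^sup>2 * (m\<^sup>2 - (max 0 (m - inverse (real (Suc n))))\<^sup>2))) \<longlonglongrightarrow> 0"
      using m(1) by simp
  qed simp
  have "bounded (range x)" using x(2) by (auto simp: bounded_iff intro!: exI[of _ 1])
  then obtain \<rho> :: "nat \<Rightarrow> nat" where \<rho>: "strict_mono \<rho>" "Cauchy (\<lambda>n. T' (T (x (\<rho> n))))"
    using eps_compact_Cauchy_subsequence[OF K] by blast
  then obtain v where v: "(\<lambda>n. T' (T (x (\<rho> n)))) \<longlonglongrightarrow> v" using Cauchy_convergent convergent_def by blast
  have "(\<lambda>n. T' (T (x (\<rho> n))) - m\<^sup>2 *\<^sub>R x (\<rho> n)) \<longlonglongrightarrow> 0"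
    using LIMSEQ_subseq_LIMSEQ[OF defect \<rho>(1)] by (simp add: o_def)
  from tendsto_diff[OF v this] have "(\<lambda>n. m\<^sup>2 *\<^sub>R x (\<rho> n)) \<longlonglongrightarrow> v" by simp
  from tendsto_scaleR[OF tendsto_const[of "1 / m\<^sup>2"] this]
  have xl: "(\<lambda>n. x (\<rho> n)) \<longlonglongrightarrow> (1 / m\<^sup>2) *\<^sub>R v" using m(1) by simp
  define l where "l = (1 / m\<^sup>2) *\<^sub>R v"
  have "(\<lambda>n. T' (T (x (\<rho> n)))) \<longlonglongrightarrow> T' (T l)"
    unfolding l_def
    by (intro bounded_linear.tendsto[OF bounded_clinearD(7)[OF T]]
        bounded_linear.tendsto[OF bounded_clinearD(7)[OF T']] xl)
  then have "T' (T l) = v" using v LIMSEQ_unique by blast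
  then have "T' (T l) = m\<^sup>2 *\<^sub>R l" using m(1) by (simp add: l_def)
  moreover have "l \<in> W" using closed_sequentially[OF W(2) _ xl] x(1) by (simp add: l_def)
  moreover have "norm l = 1"
    using tendsto_norm[OF xl[folded l_def]] x(2) by (simp add: LIMSEQ_const_iff)
  ultimately show ?thesis using that by force
qed

section \<open>Absolute-\<open>(p,r)\<close>-paranormal operators\<close>

context
  fixes T T' :: "'a::complex_hilbert \<Rightarrow> 'a" and p r :: real
  assumes T: "bounded_clinear T" and T': "bounded_clinear T'" and adj: "is_adjoint T T'"
    and p: "p > 0" and r: "r > 0"
    and para: "\<And>x. norm (op_powr (op_powr (T \<circ> T') (1/2)) r x) powr (p + r)
      \<le> norm (op_powr (op_powr (T' \<circ> T) (1/2)) p (op_powr (op_powr (T \<circ> T') (1/2)) r x)) powr r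
        * norm x powr p"
begin

private abbreviation (input) "C \<equiv> op_powr (T' \<circ> T) (1/2)"
private abbreviation (input) "D \<equiv> op_powr (T \<circ> T') (1/2)"

private lemma pos_A: "pos_op (T' \<circ> T)" and pos_B: "pos_op (T \<circ> T')"
  using pos_op_adjoint_comp[OF T adj] pos_op_adjoint_comp[OF T' is_adjoint_sym[OF adj]] by auto

private lemma pos_C: "pos_op C" and pos_D: "pos_op D"
  using pos_op_powr[OF pos_A, of "1/2"] pos_op_powr[OF pos_B, of "1/2"] by simp_all

text \<open>
  The chain \<open>A B\<close>, \<open>|T| B\<close>, \<open>|T|\<^sup>p B\<close>, \<open>|T|\<^sup>p |T\<^sup>*|\<close>, \<open>|T|\<^sup>p |T\<^sup>*|\<^sup>r\<close> of compact operators ends where the paranormality inequality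
  applies.
\<close>

lemma compact_square_imp_compact:
  assumes K: "eps_compact (\<lambda>x. T (T x))"
  shows "eps_compact (\<lambda>x. T' (T x))"
proof -
  note bl = bounded_clinearD(7)
  have "eps_compact (\<lambda>x. T' (T (T (T' x))))"
    by (rule eps_compact_comp_left[OF eps_compact_comp_right[OF K bl[OF T']] bl[OF T']])
  then have "eps_compact (\<lambda>x. (T' \<circ> T) ((T \<circ> T') x))" by simp
  note left = eps_compact_op_powr_left[OF _ pos_opD(1)[OF pos_B] _ ]
  have half: "(1 / 2 :: real) > 0" by simp
  note Cp = op_powr_bounded_clinear[OF pos_C p]
  have "eps_compact (\<lambda>x. op_powr C p ((T \<circ> T') x))"
    by (rule left[OF pos_C p left[OF pos_A half]]) fact
  then have "eps_compact (\<lambda>x. op_powr C p (D x))"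
    by (rule eps_compact_op_powr_right[OF pos_B Cp half])
  then have K2: "eps_compact (\<lambda>x. op_powr C p (op_powr D r x))"
    by (rule eps_compact_op_powr_right[OF pos_D Cp r])
  have "eps_compact (op_powr D r)"
    by (rule eps_compact_dominated[OF K2 _ _ para])
       (use p r bl[OF bounded_clinear_comp[OF Cp op_powr_bounded_clinear[OF pos_D r]]]
          bl[OF op_powr_bounded_clinear[OF pos_D r]] in auto)
  then have D: "eps_compact D" by (rule eps_compact_of_op_powr[OF pos_D r])
  have "eps_compact T'"
    by (rule eps_compact_dominated[OF D bl[OF pos_opD(1)[OF pos_D]] bl[OF T'], of 1 1 0])
       (simp_all add: norm_sqrt_adjoint_comp[OF T' is_adjoint_sym[OF adj]] bounded_clinearD(3)[OF T'])
  then show ?thesis by (rule eps_compact_comp_right) (rule bl[OF T])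
qed

text \<open>
  Paranormality turns \<open>B y = m\<^sup>2 y\<close> into \<open>\<parallel>C\<^sup>p y\<parallel> \<ge> m\<^sup>p \<parallel>y\<parallel>\<close> with \<open>C = |T|\<close>. As \<open>C\<^sup>p\<close> has norm at most \<open>m\<^sup>p\<close> on \<open>W\<close>, the vector
  \<open>y\<close> is an eigenvector of \<open>C\<^sup>2\<^sup>p\<close>. To descend to \<open>C\<close> itself, take a multiple \<open>t + 1\<close> of \<open>2 p\<close> above \<open>1\<close>: then
  \<open>m\<^sup>t\<^sup>+\<^sup>1 \<parallel>y\<parallel> = \<parallel>C\<^sup>t C y\<parallel> \<le> m\<^sup>t \<parallel>C y\<parallel>\<close>, so \<open>T\<close> attains the norm \<open>m\<close> at \<open>y\<close>.
\<close>

lemma eigenvector_transfer: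
  assumes W: "csubspace W" "closed W" "T ` W \<subseteq> W" "T' ` W \<subseteq> W"
    and m: "m > 0" "\<And>y. y \<in> W \<Longrightarrow> norm (T y) \<le> m * norm y"
    and y: "y \<in> W" "T (T' y) = m\<^sup>2 *\<^sub>R y"
  shows "T' (T y) = m\<^sup>2 *\<^sub>R y"
proof (cases "y = 0")
  case True
  then show ?thesis by (simp add: bounded_clinearD[OF T] bounded_clinearD[OF T'])
next
  case False
  have WA: "(T' \<circ> T) ` W \<subseteq> W" using W by auto
  have WC: "C ` W \<subseteq> W" using op_powr_invariant[OF pos_A _ W(1,2) WA, of "1/2"] by auto
  have Cle: "norm (C z) \<le> m * norm z" if "z \<in> W" for z
    using m(2)[OF that] by (simp add: norm_sqrt_adjoint_comp[OF T adj])
  have Csle: "norm (op_powr C t z) \<le> m powr t * norm z" if "t > 0" "z \<in> W" for t z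
    using norm_op_powr_le_on[OF pos_C that(1) W(1) WC that(2)] m(1) Cle by auto
  have CsW: "op_powr C t z \<in> W" if "t > 0" "z \<in> W" for t z
    using op_powr_invariant[OF pos_C that(1) W(1,2) WC that(2)] .
  have "D y = (m\<^sup>2 powr (1/2)) *\<^sub>R y"
    by (rule op_powr_eigenvector[OF pos_B]) (use y in auto)
  then have "D y = m *\<^sub>R y" using m by (simp add: powr_half_sqrt)
  then have Dr: "op_powr D r y = (m powr r) *\<^sub>R y"
    by (intro op_powr_eigenvector[OF pos_D r]) (use m in auto)
  define E where "E = op_powr C p"
  have E: "bounded_clinear E" "is_adjoint E E"
    using op_powr_bounded_clinear[OF pos_C p] op_powr_is_adjoint[OF pos_C p] by (auto simp: E_def)
  have EE: "norm (E y) \<ge> m powr p * norm y"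
  proof (rule ccontr)
    assume "\<not> norm (E y) \<ge> m powr p * norm y"
    then have "norm (E y) powr r < (m powr p * norm y) powr r" using r by (intro powr_less_mono2) auto
    then have "(m powr r * norm (E y)) powr r * norm y powr p
        < (m powr r * (m powr p * norm y)) powr r * norm y powr p"
      using m False by (simp add: powr_mult)
    also have "\<dots> = (m powr r * norm y) powr (p + r)"
      using m False by (simp add: powr_mult powr_powr powr_add algebra_simps)
    finally show False
      using para[of y] m(1) by (simp add: Dr bounded_clinearD(6)[OF E(1)] flip: E_def)
  qed
  have "E (E y) = (m powr p)\<^sup>2 *\<^sub>R y"
    by (rule eigenvector_if_norm_attained[OF E(2) _ EE])
       (auto simp: E_def intro!: Csle CsW p y)
  moreover have "op_powr C (2 * p) y = E (E y)"
    unfolding mult_2 E_def by (rule op_powr_add[OF pos_C p p, symmetric])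
  moreover have "(m powr p)\<^sup>2 = m powr (2 * p)" by (simp only: mult_2 powr_add power2_eq_square)
  ultimately have C2p: "op_powr C (2 * p) y = (m powr (2 * p)) *\<^sub>R y" by simp
  have p2: "2 * p > 0" using p by simp
  have iter: "op_powr C (2 * p * real (Suc n)) y = (m powr (2 * p * real (Suc n))) *\<^sub>R y" for n
  proof (induction n)
    case 0
    show ?case using C2p by (simp only: One_nat_def[symmetric] of_nat_1 mult_1_right)
  next
    case (Suc n)
    define t where "t = 2 * p * real (Suc n)"
    have t: "t > 0" using p by (simp add: t_def)
    have "op_powr C (t + 2 * p) y = op_powr C t ((m powr (2 * p)) *\<^sub>R y)"
      using op_powr_add[OF pos_C t p2, of y] C2p by simp
    also have "\<dots> = (m powr (2 * p)) *\<^sub>R op_powr C t y"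
      by (rule bounded_clinearD(6)[OF op_powr_bounded_clinear[OF pos_C t]])
    also have "\<dots> = (m powr (t + 2 * p)) *\<^sub>R y"
      by (simp only: Suc[folded t_def] powr_add scaleR_scaleR mult.commute)
    finally have step: "op_powr C (t + 2 * p) y = (m powr (t + 2 * p)) *\<^sub>R y" .
    have "t + 2 * p = 2 * p * real (Suc (Suc n))" by (simp add: t_def algebra_simps)
    then show ?case using step by (simp only:)
  qed
  \<comment> \<open>An exponent above \<open>1\<close>, from which a single factor \<open>C\<close> can be split off.\<close>
  obtain n where n: "1 / (2 * p) < real (Suc n)"
    using reals_Archimedean2 less_trans lessI of_nat_less_iff by metis
  define t where "t = 2 * p * real (Suc n) - 1"
  have t: "t > 0" using n p by (simp add: t_def field_simps del: of_nat_Suc)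
  have "m powr t * (m * norm y) = m powr (t + 1) * norm y" using m by (simp add: powr_add)
  also have "\<dots> = norm (op_powr C (t + 1) y)" using iter[of n] by (simp add: t_def del: of_nat_Suc)
  also have "\<dots> = norm (op_powr C t (C y))"
    using op_powr_add[OF pos_C t, of 1 y] op_powr_one[OF pos_C] by simp
  also have "\<dots> \<le> m powr t * norm (C y)" using WC y t by (intro Csle) auto
  finally have "m * norm y \<le> norm (T y)"
    using m by (simp add: norm_sqrt_adjoint_comp[OF T adj])
  then show ?thesis
    by (intro eigenvector_if_norm_attained[OF adj])
       (use m y W norm_adjoint_le_on[OF adj m(2) W(4)] in auto)
qed

text \<open>
  The scaled operator \<open>F = T / m\<close> is an isometry of the eigenspace \<open>M\<close> of \<open>T\<^sup>* T\<close> into itself, and its values are eigenvectors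
  of \<open>T T\<^sup>*\<close>. Compactness makes two orbit points \<open>F\<^sup>i x\<close> and \<open>F\<^sup>j x\<close>, \<open>i < j\<close>, close to each other; cancelling the isometry
  \<open>F\<^sup>i\<close> shows that \<open>x\<close> is close to \<open>F\<^sup>j\<^sup>-\<^sup>i x\<close>, an eigenvector of \<open>T T\<^sup>*\<close>.
\<close>

lemma eigenvector_recurrence:
  assumes K: "eps_compact (\<lambda>x. T' (T x))" and W: "csubspace W" "closed W" "T ` W \<subseteq> W" "T' ` W \<subseteq> W"
    and m: "m > 0" "\<And>y. y \<in> W \<Longrightarrow> norm (T y) \<le> m * norm y"
    and x: "x \<in> W" "T' (T x) = m\<^sup>2 *\<^sub>R x"
  shows "T (T' x) = m\<^sup>2 *\<^sub>R x"
proof -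
  note lin = bounded_clinearD[OF T] bounded_clinearD[OF T']
  define M where "M = {x \<in> W. T' (T x) = m\<^sup>2 *\<^sub>R x}"
  define F where "F = (\<lambda>x. (1 / m) *\<^sub>R T x)"
  have BT: "T (T' (F u)) = m\<^sup>2 *\<^sub>R F u" if "u \<in> M" for u
    using that by (simp add: M_def F_def lin(1-6,8-13))
  have FM: "F u \<in> M" if u: "u \<in> M" for u
  proof -
    have "F u \<in> W" unfolding F_def using u W csubspace_scaleR[OF W(1)] by (auto simp: M_def)
    then show ?thesis using eigenvector_transfer[OF W m] BT[OF u] by (simp add: M_def)
  qed
  have Fn: "norm (F u - F v) = norm (u - v)" if "u \<in> M" "v \<in> M" for u v
  proof -
    have *: "T' (T (u - v)) = m\<^sup>2 *\<^sub>R (u - v)"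
      using that by (simp add: M_def lin(1-6,8-13) scaleR_diff_right)
    have "(norm (T (u - v)))\<^sup>2 = inner (T' (T (u - v))) (u - v)"
      using is_adjoint_sym[OF adj] by (simp add: is_adjoint_def power2_norm_eq_inner)
    also have "\<dots> = (m * norm (u - v))\<^sup>2" by (simp add: * power2_norm_eq_inner power_mult_distrib)
    finally have "norm (T (u - v)) = m * norm (u - v)" using m(1) by (simp add: power2_eq_iff_nonneg)
    then show ?thesis using m(1) by (simp add: F_def lin(2) flip: scaleR_diff_right)
  qed
  have FnM: "(F ^^ n) u \<in> M" if "u \<in> M" for n u by (induction n) (use that FM in auto)
  have Fnn: "norm ((F ^^ n) u - (F ^^ n) v) = norm (u - v)" if "u \<in> M" "v \<in> M" for n u v
    by (induction n) (use that Fn FnM in auto)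
  have xM: "x \<in> M" using x by (simp add: M_def)
  have zM: "0 \<in> M" using W(1) by (simp add: M_def lin csubspace_def)
  have F0: "(F ^^ n) 0 = 0" for n by (induction n) (simp_all add: F_def lin)
  have "norm ((F ^^ n) x) = norm x" for n using Fnn[OF xM zM, of n] by (simp add: F0)
  then have bdd: "bounded (range (\<lambda>n. (F ^^ n) x))" by (auto simp: bounded_iff)
  have B: "bounded_clinear (\<lambda>y. T (T' y) - m\<^sup>2 *\<^sub>R y)"
    unfolding scaleR_scaleC
    by (rule bounded_clinear_diff[OF bounded_clinear_comp[OF T T'] bounded_clinear_scaleC])
  obtain L where L: "L > 0" "\<And>y. norm (T (T' y) - m\<^sup>2 *\<^sub>R y) \<le> L * norm y"
    using bounded_clinear_bound[OF B] by blast
  have "norm (T (T' x) - m\<^sup>2 *\<^sub>R x) \<le> 0 + e" if e: "e > 0" for e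
  proof -
    obtain \<rho> :: "nat \<Rightarrow> nat" where \<rho>: "strict_mono \<rho>"
      "\<And>i j. norm (T' (T ((F ^^ \<rho> i) x)) - T' (T ((F ^^ \<rho> j) x))) < m\<^sup>2 * e / L"
      using eps_compactD[OF K bdd, of "m\<^sup>2 * e / L"] e L(1) m(1) by auto
    define k where "k = \<rho> 1 - \<rho> 0 - 1"
    have k: "\<rho> 1 = \<rho> 0 + Suc k" using strict_monoD[OF \<rho>(1), of 0 1] by (simp add: k_def)
    define y where "y = F ((F ^^ k) x)"
    have "(F ^^ \<rho> 1) x = (F ^^ \<rho> 0) y"
      by (simp only: k funpow_add comp_def funpow.simps y_def)
    then have "norm ((F ^^ \<rho> 1) x - (F ^^ \<rho> 0) x) = norm (y - x)"
      using Fnn[OF FM[OF FnM[OF xM]] xM, of "\<rho> 0" k] by (simp add: y_def)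
    moreover have "T' (T ((F ^^ i) x)) = m\<^sup>2 *\<^sub>R (F ^^ i) x" for i using FnM[OF xM, of i] by (simp add: M_def)
    ultimately have "m\<^sup>2 * norm (y - x) < m\<^sup>2 * e / L"
      using \<rho>(2)[of 1 0] by (simp flip: scaleR_diff_right)
    then have "m\<^sup>2 * norm (y - x) < m\<^sup>2 * (e / L)" by simp
    then have yx: "norm (y - x) < e / L" by (rule mult_left_less_imp_less) simp
    have "T (T' y) = m\<^sup>2 *\<^sub>R y" unfolding y_def by (rule BT[OF FnM[OF xM]])
    then have "T (T' (x - y)) - m\<^sup>2 *\<^sub>R (x - y) = T (T' x) - m\<^sup>2 *\<^sub>R x"
      by (simp add: lin(2,9) scaleR_diff_right)
    then have "norm (T (T' x) - m\<^sup>2 *\<^sub>R x) \<le> L * norm (x - y)" using L(2) by metis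
    also have "\<dots> \<le> e" using yx L(1) by (simp add: norm_minus_commute field_simps)
    finally show ?thesis by simp
  qed
  then have "norm (T (T' x) - m\<^sup>2 *\<^sub>R x) \<le> 0" by (rule field_le_epsilon)
  then show ?thesis by simp
qed

text \<open>
  The orthogonal complement \<open>W\<close> of the largest part \<open>N\<close> on which \<open>T\<close> is normal is shown to be \<open>0\<close>. The scalars \<open>c\<close> in
  its definition make \<open>W\<close> a complex subspace although only the real inner product occurs.
\<close>

lemma adjoint_comp_commute_if_compact:
  assumes K: "eps_compact (\<lambda>x. T' (T x))"
  shows "T' (T x) = T (T' x)"
proof -
  note lin = bounded_clinearD(1-6)[OF T] bounded_clinearD(1-6)[OF T']
  define N where "N = \<Union>{V. T ` V \<subseteq> V \<and> T' ` V \<subseteq> V \<and> (\<forall>v\<in>V. T' (T v) = T (T' v))}"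
  have N: "T ` N \<subseteq> N" "T' ` N \<subseteq> N" "\<And>v. v \<in> N \<Longrightarrow> T' (T v) = T (T' v)"
    unfolding N_def by blast+
  define W where "W = {x. \<forall>y\<in>N. \<forall>c. inner x (c *\<^sub>C y) = 0}"
  have WN: "x = 0" if "x \<in> W" "x \<in> N" for x
    using that unfolding W_def by (metis (mono_tags, lifting) inner_eq_zero_iff mem_Collect_eq scaleC_one)
  have W1: "csubspace W"
    by (auto simp: csubspace_def W_def inner_add_left inner_scaleC_left scaleC_scaleC)
  have "W = (\<Inter>y\<in>N. \<Inter>c. {x. inner x (c *\<^sub>C y) = 0})" by (auto simp: W_def)
  then have W2: "closed W" by (auto intro!: closed_INT closed_Collect_eq continuous_intros)
  have W3: "T ` W \<subseteq> W"
  proof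
    fix z assume "z \<in> T ` W"
    then obtain x where x: "x \<in> W" "z = T x" by auto
    have "inner z (c *\<^sub>C y) = inner x (c *\<^sub>C T' y)" for y c
      using adj by (simp add: x(2) is_adjoint_def lin(11))
    then show "z \<in> W" using x(1) N(2) by (auto simp: W_def)
  qed
  have W4: "T' ` W \<subseteq> W"
  proof
    fix z assume "z \<in> T' ` W"
    then obtain x where x: "x \<in> W" "z = T' x" by auto
    have "inner z (c *\<^sub>C y) = inner x (c *\<^sub>C T y)" for y c
      using is_adjoint_sym[OF adj] by (simp add: x(2) is_adjoint_def lin(5))
    then show "z \<in> W" using x(1) N(1) by (auto simp: W_def)
  qed
  note W = W1 W2 W3 W4
  obtain m where m: "m \<ge> 0" "\<And>y. y \<in> W \<Longrightarrow> norm (T y) \<le> m * norm y"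
    "\<And>\<kappa>. \<kappa> \<ge> 0 \<Longrightarrow> (\<And>y. y \<in> W \<Longrightarrow> norm (T y) \<le> \<kappa> * norm y) \<Longrightarrow> m \<le> \<kappa>"
    using exists_least_bound_on[OF T] by metis
  have "m = 0"
  proof (rule ccontr)
    assume "m \<noteq> 0"
    then have m0: "m > 0" using m(1) by simp
    obtain u where u: "u \<in> W" "u \<noteq> 0" "T' (T u) = m\<^sup>2 *\<^sub>R u"
      using exists_top_eigenvector[OF T T' adj K W m0 m(2,3)] by blast
    define M where "M = {x \<in> W. T' (T x) = m\<^sup>2 *\<^sub>R x}"
    have B: "T (T' v) = m\<^sup>2 *\<^sub>R v" if "v \<in> M" for v
      using eigenvector_recurrence[OF K W m0 m(2)] that by (simp add: M_def)
    have "T ` M \<subseteq> M"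
      using W(3) eigenvector_transfer[OF W m0 m(2)] by (auto simp: M_def lin(6))
    moreover have "T' ` M \<subseteq> M"
      using W(4) B by (auto simp: M_def lin(12))
    moreover have "\<forall>v\<in>M. T' (T v) = T (T' v)" using B by (simp add: M_def)
    ultimately have "M \<subseteq> N" unfolding N_def by blast
    then show False using WN[OF u(1)] u by (auto simp: M_def)
  qed
  then have TW: "T y = 0" if "y \<in> W" for y using m(2)[OF that] by simp
  have T'W: "T' y = 0" if "y \<in> W" for y
    using norm_adjoint_le_on[OF adj, of W 0, OF _ W(4) that] TW by simp
  have "\<forall>v\<in>W. T' (T v) = T (T' v)" by (simp add: TW T'W lin(3,9))
  then have "W \<subseteq> N" unfolding N_def using W(3,4) by blast
  then have W0: "z = 0" if "z \<in> W" for z using WN that by blast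
  have "inner (T' (T x) - T (T' x)) (c *\<^sub>C y) = 0" if y: "y \<in> N" for c y
  proof -
    have "inner (T' (T x) - T (T' x)) (c *\<^sub>C y) = inner x (T' (T (c *\<^sub>C y))) - inner x (T (T' (c *\<^sub>C y)))"
      using adj is_adjoint_sym[OF adj] by (simp add: is_adjoint_def inner_diff_left)
    also have "\<dots> = 0" by (simp add: lin(5,11) N(3)[OF y])
    finally show ?thesis .
  qed
  then have "T' (T x) - T (T' x) \<in> W" by (simp add: W_def)
  then show ?thesis using W0 by fastforce
qed

end

text \<open>
  Scaling a nonzero \<open>x\<close> to norm \<open>1\<close> costs the factor \<open>\<parallel>x\<parallel>\<^sup>p\<close>.
\<close>

lemma absolute_paranormal_homogeneous:
  fixes T :: "'a::complex_hilbert \<Rightarrow> 'a"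
  assumes T: "bounded_clinear T" and p: "p > 0" and r: "r > 0" and ap: "absolute_paranormal p r T"
  shows "norm (op_powr (abs_star_op T) r x) powr (p + r)
    \<le> norm (op_powr (abs_op T) p (op_powr (abs_star_op T) r x)) powr r * norm x powr p"
proof -
  note adj = is_adjoint_cadjoint[OF T]
  note T' = is_adjoint_bounded_clinear[OF T adj]
  have "pos_op (abs_op T)" "pos_op (abs_star_op T)"
    unfolding abs_op_def abs_star_op_def
    by (rule pos_op_powr[OF pos_op_adjoint_comp[OF T adj]],
        simp, rule pos_op_powr[OF pos_op_adjoint_comp[OF T' is_adjoint_sym[OF adj]]], simp)
  note lin = op_powr_bounded_clinear[OF this(1) p] op_powr_bounded_clinear[OF this(2) r]
  define S where "S = op_powr (abs_star_op T) r"
  define G where "G = op_powr (abs_op T) p"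
  note scale = bounded_clinearD(3,6)[OF lin(1)] bounded_clinearD(3,6)[OF lin(2)]
  have "norm (S x) powr (p + r) \<le> norm (G (S x)) powr r * norm x powr p"
  proof (cases "x = 0")
    case True
    then show ?thesis using scale by (simp add: S_def G_def)
  next
    case False
    define n where "n = norm x"
    have n: "n > 0" using False by (simp add: n_def)
    have "norm (S ((1 / n) *\<^sub>R x)) powr (p + r) \<le> norm (G (S ((1 / n) *\<^sub>R x))) powr r"
      using ap n unfolding absolute_paranormal_def S_def G_def by (simp add: n_def)
    then have "norm (S x) powr (p + r) / n powr (p + r) \<le> norm (G (S x)) powr r / n powr r"
      using n scale by (simp add: S_def G_def powr_divide)
    then show ?thesis using n by (simp add: powr_add field_simps n_def)
  qed
  then show ?thesis by (simp add: S_def G_def)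
qed

theorem corollary4p4:
  fixes T :: "'a::complex_hilbert \<Rightarrow> 'a" and p r :: real
  assumes "bounded_clinear T"
    and "p > 0" and "r > 0"
    and "absolute_paranormal p r T"
    and "compact_op (T \<circ> T)"
  shows "normal_op T"
proof -
  note adj = is_adjoint_cadjoint[OF assms(1)]
  note T' = is_adjoint_bounded_clinear[OF assms(1) adj]
  note para = absolute_paranormal_homogeneous[OF assms(1-4), unfolded abs_op_def abs_star_op_def]
  have "eps_compact (\<lambda>x. T (T x))"
    using compact_op_imp_eps_compact[OF assms(5)] by (simp add: o_def)
  then have "eps_compact (\<lambda>x. cadjoint T (T x))"
    by (rule compact_square_imp_compact[OF assms(1) T' adj assms(2,3) para])
  then have "cadjoint T (T x) = T (cadjoint T x)" for x
    by (rule adjoint_comp_commute_if_compact[OF assms(1) T' adj assms(2,3) para])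
  then show ?thesis by (simp add: normal_op_def fun_eq_iff)
qed

end
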